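(* For each of the following tied six-blades, and for every choice of over/under information at its crossings, the resulting closed curve is a trivial knot (a circle): (i) $A1A2, A1C2, A1C4, A1C6, A1D1, A1D2, A1D3, A2C1, A2C3, A2C5, A2D1, A2D2, A2D3, B1B2, B1B3, B1C2, B1C3, B1C5, B1C6, B1D1, B1D2, B2B3, B2C1, B2C3, B2C4, B2C6, B2D2, B2D3$; (ii) $C1C3, C1C4, C1C5, C2C4, C2C5, C2C6, C3C5, C3C6, C4C6$.
   Context: Six blades numbered $1,\dots,6$ are drawn as parallel horizontal segments stacked in order in the plane. The six left ends are tied in pairs and the six right ends are tied in pairs. A tying pattern on one side is a partition of $\{1,\dots,6\}$ into three pairs; writing $ij$ for $\{i,j\}$, the patterns used here are: $A1=\{12,34,56\}$, $A2=\{16,23,45\}$, $B1=\{12,36,45\}$, $B2=\{14,23,56\}$, $B3=\{16,25,34\}$, $C1=\{12,35,46\}$, $C2=\{15,23,46\}$, $C3=\{15,26,34\}$, $C4=\{13,26,45\}$, $C5=\{13,24,56\}$, $C6=\{16,24,35\}$, $D1=\{14,26,35\}$, $D2=\{13,25,46\}$, $D3=\{15,24,36\}$. On the right side each pair $ij$ is drawn as a simple arc (e.g. a semicircle) lying to the right of the blades and joining the right ends of blades $i$ and $j$; two arcs $ij$ and $kl$ cross transversally exactly once if their endpoints interleave, and are disjoint otherwise. Left ends are drawn in the same way, mirrored to the left side. The tied six-blade $XY$ is the closed plane projection obtained with left end $X$ and right end $Y$; at each crossing either of the two strands may be the upper one, and each choice gives a knot or link diagram. *)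

theory Defs
  imports "HOL-Analysis.Analysis"
begin

section \<open>Trivial knots\<close>

text \<open>
  Euclidean 3-space is \<^typ>\<open>complex \<times> real\<close>: the first component is the plane of projection, the
  second one is the height above it.
\<close>

type_synonym space = "complex \<times> real"

definition ambient_isotopic :: "space set \<Rightarrow> space set \<Rightarrow> bool" where
  "ambient_isotopic K L \<longleftrightarrow>
     (\<exists>H :: real \<Rightarrow> space \<Rightarrow> space.
        continuous_on ({0..1} \<times> UNIV) (\<lambda>(t, x). H t x) \<and>
        (\<forall>t\<in>{0..1}. \<exists>G. homeomorphism UNIV UNIV (H t) G) \<and>
        H 0 = id \<and> H 1 ` K = L)"

definition standard_circle :: "space set" where
  "standard_circle = {(z, 0) | z. norm z = 1}"

definition trivial_knot :: "space set \<Rightarrow> bool" where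
  "trivial_knot K \<longleftrightarrow> ambient_isotopic standard_circle K"


section \<open>Tied six-blades\<close>

text \<open>A pair \<open>ij\<close> with \<open>i < j\<close> is encoded as \<open>(i, j)\<close>.\<close>

type_synonym pattern = "(nat \<times> nat) set"

definition A1 :: pattern where "A1 = {(1,2), (3,4), (5,6)}"
definition A2 :: pattern where "A2 = {(1,6), (2,3), (4,5)}"
definition B1 :: pattern where "B1 = {(1,2), (3,6), (4,5)}"
definition B2 :: pattern where "B2 = {(1,4), (2,3), (5,6)}"
definition B3 :: pattern where "B3 = {(1,6), (2,5), (3,4)}"
definition C1 :: pattern where "C1 = {(1,2), (3,5), (4,6)}"
definition C2 :: pattern where "C2 = {(1,5), (2,3), (4,6)}"
definition C3 :: pattern where "C3 = {(1,5), (2,6), (3,4)}"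
definition C4 :: pattern where "C4 = {(1,3), (2,6), (4,5)}"
definition C5 :: pattern where "C5 = {(1,3), (2,4), (5,6)}"
definition C6 :: pattern where "C6 = {(1,6), (2,4), (3,5)}"
definition D1 :: pattern where "D1 = {(1,4), (2,6), (3,5)}"
definition D2 :: pattern where "D2 = {(1,3), (2,5), (4,6)}"
definition D3 :: pattern where "D3 = {(1,5), (2,4), (3,6)}"

datatype strand = Blade nat | LeftTie "nat \<times> nat" | RightTie "nat \<times> nat"

definition strands :: "pattern \<Rightarrow> pattern \<Rightarrow> strand set" where
  "strands X Y = Blade ` {1..6} \<union> LeftTie ` X \<union> RightTie ` Y"

text \<open>
  The plane projection: blade \<open>i\<close> is the horizontal unit segment from \<open>(0, i)\<close> to \<open>(1, i)\<close>, and
  the ties are the semicircles, on the outer side of the blades, that have the segment between the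
  two ends as diameter.
\<close>

fun drawn :: "strand \<Rightarrow> complex set" where
  "drawn (Blade i) = closed_segment (Complex 0 (real i)) (Complex 1 (real i))"
| "drawn (LeftTie (i, j)) =
     {z. Re z \<le> 0 \<and> dist z (Complex 0 ((real i + real j) / 2)) = (real j - real i) / 2}"
| "drawn (RightTie (i, j)) =
     {z. Re z \<ge> 1 \<and> dist z (Complex 1 ((real i + real j) / 2)) = (real j - real i) / 2}"

fun interleave :: "nat \<times> nat \<Rightarrow> nat \<times> nat \<Rightarrow> bool" where
  "interleave (i, j) (k, l) \<longleftrightarrow> i < k \<and> k < j \<and> j < l \<or> k < i \<and> i < l \<and> l < j"

text \<open>The encoding of crossings by interleaving ends agrees with the drawing:\<close>

lemma semicircle_iff:
  fixes x y i j :: real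
  assumes "i < j"
  shows "dist (Complex x y) (Complex c ((i + j) / 2)) = (j - i) / 2 \<longleftrightarrow> (x - c)\<^sup>2 = (y - i) * (j - y)"
proof -
  have "dist (Complex x y) (Complex c ((i + j) / 2)) = (j - i) / 2 \<longleftrightarrow>
        (dist (Complex x y) (Complex c ((i + j) / 2)))\<^sup>2 = ((j - i) / 2)\<^sup>2"
    using assms by (subst power2_eq_iff_nonneg) auto
  also have "(dist (Complex x y) (Complex c ((i + j) / 2)))\<^sup>2 = (x - c)\<^sup>2 + (y - (i + j) / 2)\<^sup>2"
    by (simp add: dist_norm cmod_def)
  also have "(x - c)\<^sup>2 + (y - (i + j) / 2)\<^sup>2 = ((j - i) / 2)\<^sup>2 \<longleftrightarrow> (x - c)\<^sup>2 = (y - i) * (j - y)"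
  proof -
    have "((j - i) / 2)\<^sup>2 - (y - (i + j) / 2)\<^sup>2 = (y - i) * (j - y)"
      by (simp add: power2_eq_square field_simps)
    then show ?thesis by linarith
  qed
  finally show ?thesis .
qed

lemma semicircles_meet:
  fixes i j k l c :: real and e :: real
  assumes "i < j" "k < l" "i < k" "j \<noteq> k" "j \<noteq> l" "e = 1 \<or> e = -1"
  defines "S \<equiv> \<lambda>a b. {z. 0 \<le> e * (Re z - c) \<and> dist z (Complex c ((a + b) / 2)) = (b - a) / 2}"
  shows "if k < j \<and> j < l then \<exists>p. S i j \<inter> S k l = {p} else S i j \<inter> S k l = {}"
proof -
  have S: "z \<in> S a b \<longleftrightarrow> 0 \<le> e * (Re z - c) \<and> (Re z - c)\<^sup>2 = (Im z - a) * (b - Im z)" if "a < b" for a b z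
    using semicircle_iff[OF that, of "Re z" "Im z" c] by (simp add: S_def)
  have radical: "(y - i) * (j - y) = (y - k) * (l - y) \<longleftrightarrow> y * (k + l - i - j) = k * l - i * j" for y
    by (auto simp: algebra_simps)
  show ?thesis
  proof (cases "k < j \<and> j < l")
    case True
    define d where "d = k + l - i - j"
    define y where "y = (k * l - i * j) / d"
    have d: "d > 0" using True assms by (simp add: d_def)
    have yi: "y - i = (k - i) * (l - i) / d" and jy: "j - y = (j - k) * (l - j) / d"
      using d by (simp_all add: y_def d_def field_simps)
    have pos: "(y - i) * (j - y) > 0"
      unfolding yi jy using d True assms by simp
    define p where "p = Complex (c + e * sqrt ((y - i) * (j - y))) y"
    have rad: "(v - i) * (j - v) = (v - k) * (l - v) \<longleftrightarrow> v = y" for v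
      unfolding radical using d by (simp add: y_def d_def field_simps)
    have "S i j \<inter> S k l = {p}"
    proof (intro set_eqI iffI)
      fix z assume "z \<in> S i j \<inter> S k l"
      then have z: "0 \<le> e * (Re z - c)" "(Re z - c)\<^sup>2 = (Im z - i) * (j - Im z)"
        "(Re z - c)\<^sup>2 = (Im z - k) * (l - Im z)"
        using S assms(1,2) by auto
      then have y: "Im z = y" using rad by metis
      have "\<bar>Re z - c\<bar> = sqrt ((y - i) * (j - y))"
        using z(2) y by (metis real_sqrt_abs)
      then have "Re z = c + e * sqrt ((y - i) * (j - y))"
        using z(1) assms(6) by auto
      then show "z \<in> {p}" using y by (simp add: p_def complex_eq_iff)
    next
      fix z assume "z \<in> {p}"
      then have [simp]: "z = p" by simp
      have "0 \<le> e * (Re p - c)" using assms(6) pos by (auto simp: p_def)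
      moreover have "(Re p - c)\<^sup>2 = (y - i) * (j - y)"
        using assms(6) pos by (auto simp: p_def power_mult_distrib)
      moreover have "Im p = y" by (simp add: p_def)
      ultimately show "z \<in> S i j \<inter> S k l"
        using S assms(1,2) rad by auto
    qed
    then show ?thesis using True by auto
  next
    case False
    have "S i j \<inter> S k l = {}"
    proof (rule ccontr)
      assume "\<not> ?thesis"
      then obtain z where z: "(Re z - c)\<^sup>2 = (Im z - i) * (j - Im z)"
        "(Re z - c)\<^sup>2 = (Im z - k) * (l - Im z)"
        unfolding S[OF assms(1)] S[OF assms(2)] Int_iff ex_in_conv[symmetric] by blast
      define y where "y = Im z"
      have 1: "0 \<le> (y - i) * (j - y)" "0 \<le> (y - k) * (l - y)"
        using z by (metis y_def zero_le_power2)+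
      then have b: "i \<le> y" "y \<le> j" "k \<le> y" "y \<le> l"
        using assms(1,2) by (auto simp: zero_le_mult_iff)
      with False assms have lj: "l < j" by auto
      have "(y - k) * (l - y) \<le> (y - i) * (l - y)" using b assms by (intro mult_right_mono) auto
      moreover have "(y - i) * (l - y) < (y - i) * (j - y)" using b lj assms by (intro mult_strict_left_mono) auto
      ultimately show False using z by (simp add: y_def)
    qed
    then show ?thesis using False by auto
  qed
qed

lemma ties_meet:
  assumes "i < j" "k < l" "i \<noteq> k" "i \<noteq> l" "j \<noteq> k" "j \<noteq> l" "tie = LeftTie \<or> tie = RightTie"
  shows "if interleave (i, j) (k, l) then \<exists>p. drawn (tie (i, j)) \<inter> drawn (tie (k, l)) = {p}
         else drawn (tie (i, j)) \<inter> drawn (tie (k, l)) = {}"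
proof -
  have main: "if i < k \<and> k < j \<and> j < l then \<exists>p. drawn (tie (i, j)) \<inter> drawn (tie (k, l)) = {p}
         else drawn (tie (i, j)) \<inter> drawn (tie (k, l)) = {}"
    if "i < j" "k < l" "i < k" "j \<noteq> k" "j \<noteq> l" for i j k l
    using assms(7)
  proof
    assume [simp]: "tie = LeftTie"
    have eq: "drawn (tie (a, b)) = {z. 0 \<le> -1 * (Re z - 0) \<and>
        dist z (Complex 0 ((real a + real b) / 2)) = (real b - real a) / 2}" for a b
      by simp
    show ?thesis
      unfolding eq using semicircles_meet[of "real i" "real j" "real k" "real l" "-1" 0] that
      by (cases "k < j \<and> j < l") (auto simp del: eq_divide_eq_numeral1)
  next
    assume [simp]: "tie = RightTie"
    have eq: "drawn (tie (a, b)) = {z. 0 \<le> 1 * (Re z - 1) \<and>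
        dist z (Complex 1 ((real a + real b) / 2)) = (real b - real a) / 2}" for a b
      by simp
    show ?thesis
      unfolding eq using semicircles_meet[of "real i" "real j" "real k" "real l" 1 1] that
      by (cases "k < j \<and> j < l") (auto simp del: eq_divide_eq_numeral1)
  qed
  show ?thesis
  proof (cases "i < k")
    case True
    then show ?thesis using main[of i j k l] assms by auto
  next
    case False
    then show ?thesis using main[of k l i j] assms by (auto simp: Int_commute)
  qed
qed

fun crosses :: "strand \<Rightarrow> strand \<Rightarrow> bool" where
  "crosses (LeftTie e) (LeftTie f) \<longleftrightarrow> interleave e f"
| "crosses (RightTie e) (RightTie f) \<longleftrightarrow> interleave e f"
| "crosses _ _ \<longleftrightarrow> False"

text \<open>
  Over/under information: \<open>over s t\<close> says that strand \<open>s\<close> is the upper one where it crosses \<open>t\<close>.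
  The values of \<open>over\<close> on strands that do not cross are irrelevant.
\<close>

definition crossing_choice :: "pattern \<Rightarrow> pattern \<Rightarrow> (strand \<Rightarrow> strand \<Rightarrow> bool) \<Rightarrow> bool" where
  "crossing_choice X Y over \<longleftrightarrow>
     (\<forall>s\<in>strands X Y. \<forall>t\<in>strands X Y. crosses s t \<longrightarrow> (over s t \<longleftrightarrow> \<not> over t s))"

text \<open>
  \<open>has_diagram X Y over K\<close>: the closed curve (or link) \<open>K\<close> in space has the tied six-blade \<open>XY\<close> with
  over/under information \<open>over\<close> as its diagram. That is, every strand is lifted by a continuous
  height function; where two strands cross, the upper one is strictly higher, and where they are
  tied together, the heights agree.
\<close>

definition has_diagram ::
    "pattern \<Rightarrow> pattern \<Rightarrow> (strand \<Rightarrow> strand \<Rightarrow> bool) \<Rightarrow> space set \<Rightarrow> bool" where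
  "has_diagram X Y over K \<longleftrightarrow>
     (\<exists>h :: strand \<Rightarrow> complex \<Rightarrow> real.
        (\<forall>s\<in>strands X Y. continuous_on (drawn s) (h s)) \<and>
        (\<forall>s\<in>strands X Y. \<forall>t\<in>strands X Y. \<forall>p\<in>drawn s \<inter> drawn t.
           if crosses s t then (over s t \<longrightarrow> h t p < h s p) else h s p = h t p) \<and>
        K = {(p, h s p) | s p. s \<in> strands X Y \<and> p \<in> drawn s})"

definition six_blades_i :: "(pattern \<times> pattern) set" where
  "six_blades_i =
     {(A1,A2), (A1,C2), (A1,C4), (A1,C6), (A1,D1), (A1,D2), (A1,D3),
      (A2,C1), (A2,C3), (A2,C5), (A2,D1), (A2,D2), (A2,D3),
      (B1,B2), (B1,B3), (B1,C2), (B1,C3), (B1,C5), (B1,C6), (B1,D1), (B1,D2),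
      (B2,B3), (B2,C1), (B2,C3), (B2,C4), (B2,C6), (B2,D2), (B2,D3)}"

definition six_blades_ii :: "(pattern \<times> pattern) set" where
  "six_blades_ii =
     {(C1,C3), (C1,C4), (C1,C5), (C2,C4), (C2,C5), (C2,C6), (C3,C5), (C3,C6), (C4,C6)}"

end

theory Submission
  imports Defs
begin

text \<open>
  Every one of these drawings has at most two crossings, so the curve can be cut at a blade in such a
  way that, for a suitable direction, at every crossing the strand traversed later is above (or, for
  all crossings, below) the earlier one. Two lifts of a drawing with the same crossing data are
  isotopic, so the height may be taken to grow steadily along the curve and to return along the blade
  that was cut. The knot then consists of two arcs which are graphs over the same interval of heights
  and meet only in their ends; such a curve is unwound level by level, with a continuous logarithm
  of the difference of the two arcs.
\<close>

section \<open>Isotopies\<close>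

text \<open>A lifted curve is merely continuous, so no isotopy extension is at hand: every motion is
  a family of homeomorphisms of the whole space with an explicit inverse. Apart from one rigid
  rotation two kinds occur: increasing affine maps of the vertical lines, which compare two lifts of
  one drawing, and maps of each horizontal plane, which reshape arcs that are graphs over the
  height. For the second kind the delicate points are the ends where the arcs meet, because the
  formulas divide by the distance of the arcs; there the displacement is bounded by a quantity that
  vanishes. Two crossings are what the cutting argument bears. A single crossing is monotone for
  every cut, and with two the cut can be moved past a passage of only one of them. With three
  crossings the trefoil shows that no such cut need exist.\<close>

text \<open>Unlike in \<^const>\<open>ambient_isotopic\<close>, the inverse is also required to be jointly continuous; this
  makes symmetry and transitivity immediate (levelwise inverse and composition).\<close>

definition isotopic :: "'a::topological_space set \<Rightarrow> 'a set \<Rightarrow> bool" where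
  "isotopic K L \<longleftrightarrow>
     (\<exists>H G :: real \<Rightarrow> 'a \<Rightarrow> 'a.
        continuous_on ({0..1} \<times> UNIV) (\<lambda>(t, x). H t x) \<and>
        continuous_on ({0..1} \<times> UNIV) (\<lambda>(t, x). G t x) \<and>
        (\<forall>t\<in>{0..1}. \<forall>x. G t (H t x) = x \<and> H t (G t x) = x) \<and>
        H 0 = id \<and> H 1 ` K = L)"

lemma isotopicI:
  fixes H G :: "real \<Rightarrow> 'a::topological_space \<Rightarrow> 'a"
  assumes "continuous_on ({0..1} \<times> UNIV) (\<lambda>(t, x). H t x)"
    and "continuous_on ({0..1} \<times> UNIV) (\<lambda>(t, x). G t x)"
    and "\<And>t x. 0 \<le> t \<Longrightarrow> t \<le> 1 \<Longrightarrow> G t (H t x) = x"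
    and "\<And>t x. 0 \<le> t \<Longrightarrow> t \<le> 1 \<Longrightarrow> H t (G t x) = x"
    and "\<And>x. H 0 x = x"
    and "H 1 ` K = L"
  shows "isotopic K L"
  unfolding isotopic_def using assms by (intro exI[of _ H] exI[of _ G]) (auto simp: id_def fun_eq_iff)

lemma isotopic_sym:
  assumes "isotopic K L"
  shows "isotopic L K"
proof -
  obtain H G :: "real \<Rightarrow> 'a \<Rightarrow> 'a" where HG:
    "continuous_on ({0..1} \<times> UNIV) (\<lambda>(t, x). H t x)"
    "continuous_on ({0..1} \<times> UNIV) (\<lambda>(t, x). G t x)"
    "\<forall>t\<in>{0..1}. \<forall>x. G t (H t x) = x \<and> H t (G t x) = x"
    "H 0 = id" "H 1 ` K = L"
    using assms unfolding isotopic_def by blast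
  have "G 0 x = x" for x
    using HG(3)[rule_format, of 0 x] HG(4) by simp
  moreover have "G 1 ` L = K"
    using HG(3)[rule_format, of 1] HG(5) by (force simp: image_iff)
  ultimately show ?thesis
    using HG by (intro isotopicI[of G H]) auto
qed

lemma isotopic_trans:
  assumes "isotopic K L" "isotopic L M"
  shows "isotopic K M"
proof -
  obtain H G :: "real \<Rightarrow> 'a \<Rightarrow> 'a" where HG:
    "continuous_on ({0..1} \<times> UNIV) (\<lambda>(t, x). H t x)"
    "continuous_on ({0..1} \<times> UNIV) (\<lambda>(t, x). G t x)"
    "\<forall>t\<in>{0..1}. \<forall>x. G t (H t x) = x \<and> H t (G t x) = x"
    "H 0 = id" "H 1 ` K = L"
    using assms(1) unfolding isotopic_def by blast
  obtain H' G' :: "real \<Rightarrow> 'a \<Rightarrow> 'a" where HG':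
    "continuous_on ({0..1} \<times> UNIV) (\<lambda>(t, x). H' t x)"
    "continuous_on ({0..1} \<times> UNIV) (\<lambda>(t, x). G' t x)"
    "\<forall>t\<in>{0..1}. \<forall>x. G' t (H' t x) = x \<and> H' t (G' t x) = x"
    "H' 0 = id" "H' 1 ` L = M"
    using assms(2) unfolding isotopic_def by blast
  have comp: "continuous_on ({0..1} \<times> UNIV) (\<lambda>(t, x). B t (A t x))"
    if A: "continuous_on ({0..1} \<times> UNIV) (\<lambda>(t, x). A t x)"
      and B: "continuous_on ({0..1} \<times> UNIV) (\<lambda>(t, x). B t x)"
    for A B :: "real \<Rightarrow> 'a \<Rightarrow> 'a"
  proof -
    have "continuous_on ({0..1} \<times> UNIV) (\<lambda>p. (fst p, (\<lambda>(t, x). A t x) p))"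
      using A by (intro continuous_intros) auto
    from continuous_on_compose2[OF B this] show ?thesis
      by (simp add: case_prod_beta image_subset_iff)
  qed
  show ?thesis
    using HG HG' comp[OF HG(1) HG'(1)] comp[OF HG'(2) HG(2)]
    by (intro isotopicI[of "\<lambda>t x. H' t (H t x)" "\<lambda>t x. G t (G' t x)"]) (auto simp: image_comp[symmetric] o_def)
qed

text \<open>Conjugate the isotopy by \<open>f\<close>. This serves the reflection in the plane of
  projection, which reverses orientation and so cannot be reached by an isotopy itself.\<close>

lemma isotopic_homeomorphic_image:
  fixes f :: "'a::topological_space \<Rightarrow> 'a"
  assumes "isotopic K L" "homeomorphism UNIV UNIV f g"
  shows "isotopic (f ` K) (f ` L)"
proof -
  obtain H G :: "real \<Rightarrow> 'a \<Rightarrow> 'a" where HG: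
    "continuous_on ({0..1} \<times> UNIV) (\<lambda>(t, x). H t x)"
    "continuous_on ({0..1} \<times> UNIV) (\<lambda>(t, x). G t x)"
    "\<forall>t\<in>{0..1}. \<forall>x. G t (H t x) = x \<and> H t (G t x) = x"
    "H 0 = id" "H 1 ` K = L"
    using assms(1) unfolding isotopic_def by blast
  have fg: "g (f x) = x" "f (g x) = x" and contf: "continuous_on UNIV f" and contg: "continuous_on UNIV g" for x
    using assms(2) by (auto simp: homeomorphism_def)
  have conj: "continuous_on ({0..1} \<times> UNIV) (\<lambda>(t, x). f (A t (g x)))"
    if A: "continuous_on ({0..1} \<times> UNIV) (\<lambda>(t, x). A t x)"
    for A :: "real \<Rightarrow> 'a \<Rightarrow> 'a"
  proof -
    have "continuous_on ({0..1} \<times> UNIV) (\<lambda>p::real \<times> 'a. (fst p, g (snd p)))"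
      by (intro continuous_intros continuous_on_compose2[OF contg]) auto
    from continuous_on_compose2[OF contf continuous_on_compose2[OF A this]] show ?thesis
      by (simp add: case_prod_beta image_subset_iff)
  qed
  show ?thesis
    using HG fg conj[OF HG(1)] conj[OF HG(2)]
    by (intro isotopicI[of "\<lambda>t x. f (H t (g x))" "\<lambda>t x. f (G t (g x))"]) (auto simp: image_image)
qed

lemma isotopic_imp_ambient_isotopic:
  assumes "isotopic K L"
  shows "ambient_isotopic K L"
proof -
  obtain H G :: "real \<Rightarrow> space \<Rightarrow> space" where HG:
    "continuous_on ({0..1} \<times> UNIV) (\<lambda>(t, x). H t x)"
    "continuous_on ({0..1} \<times> UNIV) (\<lambda>(t, x). G t x)"
    "\<forall>t\<in>{0..1}. \<forall>x. G t (H t x) = x \<and> H t (G t x) = x"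
    "H 0 = id" "H 1 ` K = L"
    using assms unfolding isotopic_def by blast
  have slice: "continuous_on UNIV (A t)"
    if "t \<in> {0..1}" and A: "continuous_on ({0..1} \<times> UNIV) (\<lambda>(t, x). A t x)"
    for t and A :: "real \<Rightarrow> space \<Rightarrow> space"
  proof -
    have "continuous_on UNIV (\<lambda>x::space. (t, x))"
      by (intro continuous_intros)
    from continuous_on_compose2[OF A this] that show ?thesis by (simp add: image_subset_iff)
  qed
  have "homeomorphism UNIV UNIV (H t) (G t)" if "t \<in> {0..1}" for t
    using HG(3) slice[OF that] HG(1,2) that
    by (intro homeomorphismI) auto
  then show ?thesis
    unfolding ambient_isotopic_def using HG by (intro exI[of _ H]) blast
qed

text \<open>Scaling \<open>l\<close> and \<open>d\<close> by the time starts at the identity and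
  keeps the factor \<open>exp (t * l z)\<close> positive throughout, so every stage is invertible on
  each vertical line.\<close>

lemma isotopic_fibrewise_affine:
  fixes l d :: "complex \<Rightarrow> real"
  assumes "continuous_on UNIV l" "continuous_on UNIV d"
  shows "isotopic K ((\<lambda>(z, u). (z, exp (l z) * u + d z)) ` K)"
proof -
  have fst: "continuous_on S (\<lambda>p. l (fst (snd p)))" "continuous_on S (\<lambda>p. d (fst (snd p)))"
    for S :: "(real \<times> complex \<times> real) set"
    by (rule continuous_on_compose2[OF assms(1)] continuous_on_compose2[OF assms(2)];
        auto intro!: continuous_intros)+
  show ?thesis
  proof (rule isotopicI)
    show "continuous_on ({0..1} \<times> UNIV)
        (\<lambda>(t, x). case x of (z, u) \<Rightarrow> (z, exp (t * l z) * u + t * d z))"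
      unfolding case_prod_beta by (intro continuous_intros fst)
    show "continuous_on ({0..1} \<times> UNIV)
        (\<lambda>(t, x). case x of (z, u) \<Rightarrow> (z, exp (- (t * l z)) * (u - t * d z)))"
      unfolding case_prod_beta by (intro continuous_intros fst)
  qed (auto simp: exp_minus field_simps)
qed

lemma isotopic_levelwise_affine:
  fixes l d :: "real \<Rightarrow> complex"
  assumes "continuous_on UNIV l" "continuous_on UNIV d"
  shows "isotopic K ((\<lambda>(z, u). (exp (l u) * z + d u, u)) ` K)"
proof -
  have snd: "continuous_on S (\<lambda>p. l (snd (snd p)))" "continuous_on S (\<lambda>p. d (snd (snd p)))"
    for S :: "(real \<times> complex \<times> real) set"
    by (rule continuous_on_compose2[OF assms(1)] continuous_on_compose2[OF assms(2)];
        auto intro!: continuous_intros)+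
  show ?thesis
  proof (rule isotopicI)
    show "continuous_on ({0..1} \<times> UNIV)
        (\<lambda>(t, x). case x of (z, u) \<Rightarrow> (exp (of_real t * l u) * z + of_real t * d u, u))"
      unfolding case_prod_beta by (intro continuous_intros snd)
    show "continuous_on ({0..1} \<times> UNIV)
        (\<lambda>(t, x). case x of (z, u) \<Rightarrow> (exp (- (of_real t * l u)) * (z - of_real t * d u), u))"
      unfolding case_prod_beta by (intro continuous_intros snd)
  qed (auto simp: exp_minus field_simps)
qed

text \<open>A quarter turn about the real axis; \<open>\<sigma>\<close> is the sense of rotation,
  and the opposite sense gives the inverse. Curves unwound level by level end in this upright
  position.\<close>

lemma isotopic_tilted_circle:
  "isotopic {(Complex x 0, u) | x u. x\<^sup>2 + u\<^sup>2 = 1} standard_circle"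
proof (rule isotopicI)
  let ?H = "\<lambda>\<sigma> t (z, u). (Complex (Re z) (Im z * cos (t * pi / 2) - \<sigma> * u * sin (t * pi / 2)),
              \<sigma> * Im z * sin (t * pi / 2) + u * cos (t * pi / 2))"
  have cont: "continuous_on ({0..1} \<times> UNIV) (\<lambda>(t, x). ?H \<sigma> t x)" for \<sigma>
    unfolding case_prod_beta complex_eq by (intro continuous_intros) auto
  show "continuous_on ({0..1} \<times> UNIV) (\<lambda>(t, x). ?H 1 t x)"
    "continuous_on ({0..1} \<times> UNIV) (\<lambda>(t, x). ?H (-1) t x)"
    by (rule cont)+
  have *: "(a * c - b * s) * c + (a * s + b * c) * s = a" "(a * s + b * c) * c - (a * c - b * s) * s = b"
    if "s\<^sup>2 + c\<^sup>2 = 1" for a b c s :: real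
  proof -
    have "(a * c - b * s) * c + (a * s + b * c) * s = a * (s\<^sup>2 + c\<^sup>2)"
      "(a * s + b * c) * c - (a * c - b * s) * s = b * (s\<^sup>2 + c\<^sup>2)"
      by algebra+
    then show "(a * c - b * s) * c + (a * s + b * c) * s = a" "(a * s + b * c) * c - (a * c - b * s) * s = b"
      using that by auto
  qed
  show "?H (-1) t (?H 1 t x) = x" for t x
    using *[OF sin_cos_squared_add[of "t * pi / 2"], of "Im (fst x)" "snd x"]
    by (cases x) (auto simp: complex_eq_iff)
  show "?H 1 t (?H (-1) t x) = x" for t x
    using *[of "- sin (t * pi / 2)" "cos (t * pi / 2)", of "Im (fst x)" "snd x"] sin_cos_squared_add[of "t * pi / 2"]
    by (cases x) (auto simp: complex_eq_iff)
  show "?H 1 0 x = x" for x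
    by (cases x) (auto simp: complex_eq_iff)
  show "?H 1 1 ` {(Complex x 0, u) | x u. x\<^sup>2 + u\<^sup>2 = 1} = standard_circle" (is "?f ` ?C = _")
  proof (intro set_eqI iffI)
    fix p assume "p \<in> ?f ` ?C"
    then show "p \<in> standard_circle" by (auto simp: standard_circle_def cmod_def)
  next
    fix p assume "p \<in> standard_circle"
    then obtain z where z: "p = (z, 0)" "norm z = 1" by (auto simp: standard_circle_def)
    then have "(Re z)\<^sup>2 + (Im z)\<^sup>2 = 1" using cmod_power2[of z] by simp
    \<comment> \<open>The completed turn sends height \<open>u\<close> to imaginary part
      \<open>- u\<close>, hence the sign.\<close>
    then have "(Complex (Re z) 0, - Im z) \<in> ?C" by auto
    moreover have "?f (Complex (Re z) 0, - Im z) = p" using z by (simp add: complex_eq_iff)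
    ultimately show "p \<in> ?f ` ?C" by (metis (no_types, lifting) image_eqI)
  qed
qed

text \<open>At points outside \<open>U\<close> the bound \<open>g\<close> vanishes and forces
  \<open>f\<close> to tend to 0. This handles formulas that divide by a distance which degenerates
  at the ends of the arcs.\<close>

lemma continuous_on_dominated:
  fixes f :: "'a::topological_space \<Rightarrow> 'b::real_normed_vector"
  assumes "open U" "continuous_on (T \<inter> U) f" "continuous_on T g"
    and "\<And>x. x \<in> T \<Longrightarrow> norm (f x) \<le> g x" "\<And>x. x \<in> T - U \<Longrightarrow> g x = 0"
  shows "continuous_on T f"
  unfolding continuous_on_def
proof
  fix x assume x: "x \<in> T"
  show "(f \<longlongrightarrow> f x) (at x within T)"
  proof (cases "x \<in> U")
    case True
    have "at x within (T \<inter> U) = at x within T"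
      using assms(1) True by (auto intro: at_within_nhd)
    then show ?thesis
      using assms(2) x True by (metis IntI continuous_on_def)
  next
    case False
    have "(g \<longlongrightarrow> 0) (at x within T)"
      using assms(3,5) x False unfolding continuous_on_def by (metis DiffI)
    moreover have "\<forall>\<^sub>F y in at x within T. norm (f y) \<le> g y"
      using assms(4) by (auto simp: eventually_at_topological)
    moreover have "f x = 0"
      using assms(4)[OF x] assms(5) x False by auto
    ultimately show ?thesis
      by (auto intro: Lim_null_comparison)
  qed
qed

section \<open>Two arcs over the same interval of heights\<close>

text \<open>\<open>x \<mapsto> x + squeeze r s x\<close> stretches \<open>[0, r]\<close> linearly onto \<open>[0, s]\<close>, translates the points beyond
  \<open>r\<close> and fixes the negative ones. For \<open>r = s = 0\<close> it is the identity, and it stays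
  continuous there although \<open>s / r\<close> may be unbounded nearby.\<close>

definition squeeze :: "real \<Rightarrow> real \<Rightarrow> real \<Rightarrow> real" where
  "squeeze r s x = (s - r) * max 0 (min 1 (x / r))"

text \<open>The negative half-line, the segment up to \<open>r\<close> and the rest go onto the
  corresponding pieces for \<open>s\<close>; on each of them exchanging \<open>r\<close> and
  \<open>s\<close> undoes the map.\<close>

lemma squeeze_inverse:
  assumes "0 \<le> r" "0 \<le> s" "r = 0 \<longleftrightarrow> s = 0"
  shows "x + squeeze r s x + squeeze s r (x + squeeze r s x) = x"
proof (cases "r = 0")
  case True
  then show ?thesis using assms by (simp add: squeeze_def)
next
  case False
  then have pos: "r > 0" "s > 0" using assms by auto
  consider "x \<le> 0" | "0 \<le> x" "x \<le> r" | "r \<le> x" by linarith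
  then show ?thesis
  proof cases
    case 1
    then have "x / r \<le> 0" "x / s \<le> 0" using pos by (simp_all add: divide_nonpos_pos)
    then show ?thesis by (simp add: squeeze_def)
  next
    case 2
    then have *: "max 0 (min 1 (x / r)) = x / r" using pos by simp
    have "x + squeeze r s x = s * (x / r)"
      using pos by (simp add: squeeze_def * field_simps)
    moreover have "max 0 (min 1 (s * (x / r) / s)) = x / r" using pos 2 by simp
    ultimately show ?thesis using pos by (simp add: squeeze_def * field_simps)
  next
    case 3
    then have *: "max 0 (min 1 (x / r)) = 1" using pos by simp
    moreover have "max 0 (min 1 ((x + s - r) / s)) = 1" using pos 3 by simp
    ultimately show ?thesis by (simp add: squeeze_def add_diff_eq)
  qed
qed

text \<open>The slope \<open>B p / A p\<close> may blow up where \<open>A\<close> tends to 0, but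
  the displacement never exceeds \<open>\<bar>B p - A p\<bar>\<close>, which the last hypothesis
  makes 0 there.\<close>

lemma continuous_on_squeeze:
  fixes A B :: "'a::topological_space \<Rightarrow> real" and x :: "'a \<Rightarrow> real"
  assumes "continuous_on UNIV A" "continuous_on T B" "continuous_on T x"
    and "\<And>p. p \<in> T \<Longrightarrow> A p = 0 \<Longrightarrow> B p = 0"
  shows "continuous_on T (\<lambda>p. squeeze (A p) (B p) (x p))"
proof (rule continuous_on_dominated)
  have A: "continuous_on S A" for S
    using assms(1) continuous_on_subset by blast
  show "open {p. A p \<noteq> 0}"
    using assms(1) by (intro open_Collect_neq continuous_on_const)
  show "continuous_on (T \<inter> {p. A p \<noteq> 0}) (\<lambda>p. squeeze (A p) (B p) (x p))"
    unfolding squeeze_def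
    by (intro continuous_intros A continuous_on_subset[OF assms(2)] continuous_on_subset[OF assms(3)]) auto
  show "continuous_on T (\<lambda>p. \<bar>B p - A p\<bar>)"
    by (intro continuous_intros A assms(2))
  show "norm (squeeze (A p) (B p) (x p)) \<le> \<bar>B p - A p\<bar>" for p
  proof -
    have "\<bar>B p - A p\<bar> * max 0 (min 1 (x p / A p)) \<le> \<bar>B p - A p\<bar> * 1"
      by (intro mult_left_mono) auto
    then show ?thesis by (simp add: squeeze_def abs_mult)
  qed
qed (use assms(4) in auto)

text \<open>The straight-line interpolation of the two profiles vanishes exactly where both do.
  Hence each stage stretches a nondegenerate segment or is trivial on the level, and the stretch
  with the roles exchanged inverts it.\<close>

lemma isotopic_squeeze:
  fixes r s :: "real \<Rightarrow> real"
  assumes "continuous_on UNIV r" "continuous_on UNIV s"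
    and nonneg: "\<And>u. 0 \<le> r u" "\<And>u. 0 \<le> s u" and zero: "\<And>u. r u = 0 \<longleftrightarrow> s u = 0"
  shows "isotopic ({(0, u) | u. u \<in> I} \<union> {(of_real (r u), u) | u. u \<in> I})
                  ({(0, u) | u. u \<in> I} \<union> {(of_real (s u), u) | u. u \<in> I} :: space set)"
proof (rule isotopicI)
  define m where "m t u = (1 - t) * r u + t * s u" for t u
  have m_nonneg: "0 \<le> m t u" if "0 \<le> t" "t \<le> 1" for t u
    using that nonneg by (simp add: m_def)
  have m_zero: "m t u = 0 \<longleftrightarrow> r u = 0" if "0 \<le> t" "t \<le> 1" for t u
  proof -
    have "m t u = 0 \<longleftrightarrow> (1 - t) * r u = 0 \<and> t * s u = 0"
      unfolding m_def using that nonneg by (intro add_nonneg_eq_0_iff) auto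
    then show ?thesis using zero[of u] by auto
  qed
  have r: "continuous_on S (\<lambda>p. r (snd (snd p)))" and s: "continuous_on S (\<lambda>p. s (snd (snd p)))"
    for S :: "(real \<times> space) set"
    by (rule continuous_on_compose2[OF assms(1)] continuous_on_compose2[OF assms(2)];
        auto intro!: continuous_intros)+
  have m: "continuous_on S (\<lambda>p. m (fst p) (snd (snd p)))" for S :: "(real \<times> space) set"
    unfolding m_def by (intro continuous_intros r s)
  show "continuous_on ({0..1} \<times> UNIV)
      (\<lambda>(t, x). case x of (z, u) \<Rightarrow> (z + of_real (squeeze (r u) (m t u) (Re z)), u))"
    unfolding case_prod_beta
    by (intro continuous_intros continuous_on_squeeze r m) (auto simp: m_zero)
  show "continuous_on ({0..1} \<times> UNIV)
      (\<lambda>(t, x). case x of (z, u) \<Rightarrow> (z + of_real (squeeze (m t u) (r u) (Re z)), u))"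
    unfolding case_prod_beta
    by (intro continuous_intros continuous_on_squeeze r m) (auto simp: m_zero)
  have inv: "z + of_real (squeeze a b (Re z)) + of_real (squeeze b a (Re z + squeeze a b (Re z))) = z"
    if "0 \<le> a" "0 \<le> b" "a = 0 \<longleftrightarrow> b = 0" for a b z
    using squeeze_inverse[OF that, of "Re z"] by (simp add: complex_eq_iff)
  show "(case case x of (z, u) \<Rightarrow> (z + of_real (squeeze (r u) (m t u) (Re z)), u) of
          (z, u) \<Rightarrow> (z + of_real (squeeze (m t u) (r u) (Re z)), u)) = x"
    if "0 \<le> t" "t \<le> 1" for t x
    using inv[OF nonneg(1) m_nonneg[OF that]] m_zero[OF that] by (auto split: prod.splits)
  show "(case case x of (z, u) \<Rightarrow> (z + of_real (squeeze (m t u) (r u) (Re z)), u) of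
          (z, u) \<Rightarrow> (z + of_real (squeeze (r u) (m t u) (Re z)), u)) = x"
    if "0 \<le> t" "t \<le> 1" for t x
    using inv[OF m_nonneg[OF that] nonneg(1)] m_zero[OF that] by (auto split: prod.splits)
  show "(case x of (z, u) \<Rightarrow> (z + of_real (squeeze (r u) (m 0 u) (Re z)), u)) = x" for x
    by (auto simp: squeeze_def m_def split: prod.splits)
  have "squeeze (r u) (m 1 u) 0 = 0" "of_real (r u) + of_real (squeeze (r u) (m 1 u) (r u)) = complex_of_real (s u)" for u
    using zero[of u] by (auto simp: squeeze_def m_def complex_eq_iff)
  then show "(\<lambda>x. case x of (z, u) \<Rightarrow> (z + of_real (squeeze (r u) (m 1 u) (Re z)), u)) `
        ({(0, u) | u. u \<in> I} \<union> {(of_real (r u), u) | u. u \<in> I}) =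
      {(0, u) | u. u \<in> I} \<union> {(of_real (s u), u) | u. u \<in> I}"
    by (auto simp: image_Un image_iff)
qed

text \<open>A rotation by the argument of \<open>p u\<close>, damped to the identity outside the disc of radius \<open>2 \<bar>p u\<bar>\<close>;
  the argument may be unbounded near the ends, but the disc shrinks to a point there.\<close>

lemma isotopic_unwind:
  fixes p :: "real \<Rightarrow> complex"
  assumes p: "continuous_on UNIV p" and zero: "\<And>u. p u = 0 \<longleftrightarrow> u \<notin> {-1<..<1}"
  shows "isotopic ({(0, u) | u. u \<in> I} \<union> {(p u, u) | u. u \<in> I})
                  ({(0, u) | u. u \<in> I} \<union> {(of_real (norm (p u)), u) | u. u \<in> I} :: space set)"
proof -
  \<comment> \<open>On the contractible open interval \<open>p\<close> has no zero, hence a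
    continuous logarithm \<open>g\<close>. Its imaginary part is the winding angle, which need not
    have limits at the ends.\<close>
  have "contractible {-1<..<1::real}"
    by (intro convex_imp_contractible convex_real_interval)
  then obtain g where g: "continuous_on {-1<..<1} g" "\<And>u. u \<in> {-1<..<1} \<Longrightarrow> p u = exp (g u)"
    using continuous_logarithm_on_contractible[of "{-1<..<1}" p] continuous_on_subset[OF p] zero by blast
  \<comment> \<open>The cutoff is 1 up to radius \<open>norm (p u)\<close> and falls linearly to 0
    at twice that radius, so \<open>p u\<close> itself is turned through the full angle.\<close>
  define \<rho> where "\<rho> z u =
      (if u \<in> {-1<..<1} then - Im (g u) * max 0 (min 1 (2 - norm z / norm (p u))) else 0)" for z :: complex and u
  have pc: "continuous_on S (\<lambda>x. p (snd (snd x)))" for S :: "(real \<times> space) set"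
    by (rule continuous_on_compose2[OF p]) (auto intro!: continuous_intros)
  have far: "\<rho> z u = 0" if "2 * norm (p u) \<le> norm z" for z u
  proof (cases "u \<in> {-1<..<1}")
    case True
    then have "2 - norm z / norm (p u) \<le> 0"
      using that zero[of u] by (simp add: field_simps)
    then show ?thesis by (simp add: \<rho>_def)
  qed (auto simp: \<rho>_def)
  \<comment> \<open>The displacement of the rotation; unlike the angle it can be bounded without any
    control of \<open>g\<close>.\<close>
  define f where "f \<sigma> x = (case x of (t, z, u) \<Rightarrow> z * (cis (\<sigma> * t * \<rho> z u) - 1))"
    for \<sigma> :: real and x :: "real \<times> space"
  have f: "continuous_on UNIV (f \<sigma>)" for \<sigma>
  proof (rule continuous_on_dominated)
    let ?U = "{x :: real \<times> space. snd (snd x) \<in> {-1<..<1}}"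
    show "open ?U"
      unfolding greaterThanLessThan_iff
      by (intro open_Collect_conj open_Collect_less continuous_intros)
    have gc: "continuous_on ?U (\<lambda>x. g (snd (snd x)))"
      by (rule continuous_on_compose2[OF g(1)]) (auto intro!: continuous_intros)
    have "continuous_on ?U (\<lambda>x. - Im (g (snd (snd x))) * max 0 (min 1 (2 - norm (fst (snd x)) / norm (p (snd (snd x))))))"
      using zero by (intro continuous_intros gc pc) auto
    moreover have "- Im (g (snd (snd x))) * max 0 (min 1 (2 - norm (fst (snd x)) / norm (p (snd (snd x)))))
        = \<rho> (fst (snd x)) (snd (snd x))" if "x \<in> ?U" for x
      using that by (simp add: \<rho>_def)
    ultimately have "continuous_on ?U (\<lambda>x. \<rho> (fst (snd x)) (snd (snd x)))"
      using continuous_on_cong by (metis (no_types, lifting))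
    then show "continuous_on (UNIV \<inter> ?U) (f \<sigma>)"
      unfolding f_def case_prod_beta by (simp, intro continuous_intros)
    show "continuous_on UNIV (\<lambda>x :: real \<times> space. 4 * norm (p (snd (snd x))))"
      by (intro continuous_intros pc)
    \<comment> \<open>A point that moves has norm below \<open>2 * norm (p u)\<close>, and
      subtracting 1 from a unit complex number leaves norm at most 2; together this gives the
      4.\<close>
    show "norm (f \<sigma> x) \<le> 4 * norm (p (snd (snd x)))" for x
    proof -
      obtain t z u where x: "x = (t, z, u)" by (cases x)
      show ?thesis
      proof (cases "2 * norm (p u) \<le> norm z")
        case True
        then show ?thesis by (simp add: x f_def far)
      next
        case False
        have "norm (cis (\<sigma> * t * \<rho> z u) - 1) \<le> 2"
          using norm_triangle_ineq4[of "cis (\<sigma> * t * \<rho> z u)" 1] by simp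
        then have "norm (f \<sigma> x) \<le> norm z * 2"
          by (simp add: x f_def norm_mult mult_left_mono)
        then show ?thesis using False by (simp add: x)
      qed
    qed
  qed (use zero in auto)
  let ?H = "\<lambda>\<sigma> t (z, u). (z * cis (\<sigma> * t * \<rho> z u), u :: real)"
  have cont: "continuous_on ({0..1} \<times> UNIV) (\<lambda>(t, x). ?H \<sigma> t x)" for \<sigma>
  proof -
    have "continuous_on ({0..1} \<times> UNIV) (\<lambda>x. (fst (snd x) + f \<sigma> x, snd (snd x)))"
      by (intro continuous_intros continuous_on_subset[OF f]) auto
    then show ?thesis
      by (simp add: f_def case_prod_beta algebra_simps)
  qed
  \<comment> \<open>The angle depends on \<open>z\<close> only through its norm, so the rotation by
    the opposite angle is the inverse.\<close>
  have \<rho>_rot: "\<rho> (z * cis a) u = \<rho> z u" for z a u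
    by (simp add: \<rho>_def norm_mult)
  have unwind: "p u * cis (\<rho> (p u) u) = of_real (norm (p u))" for u
  proof (cases "u \<in> {-1<..<1}")
    case True
    then have "\<rho> (p u) u = - Im (g u)" using zero[of u] by (simp add: \<rho>_def)
    moreover have "p u = of_real (exp (Re (g u))) * cis (Im (g u))"
      using g(2)[OF True] by (simp add: exp_eq_polar)
    ultimately show ?thesis by (simp add: norm_mult cis_mult mult.assoc)
  next
    case False
    then have "p u = 0" using zero by blast
    then show ?thesis by simp
  qed
  show ?thesis
  proof (rule isotopicI)
    show "continuous_on ({0..1} \<times> UNIV) (\<lambda>(t, x). ?H 1 t x)"
      "continuous_on ({0..1} \<times> UNIV) (\<lambda>(t, x). ?H (-1) t x)"
      by (rule cont)+
    show "?H 1 1 ` ({(0, u) | u. u \<in> I} \<union> {(p u, u) | u. u \<in> I}) =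
        {(0, u) | u. u \<in> I} \<union> {(of_real (norm (p u)), u) | u. u \<in> I}"
      using unwind by (auto simp: image_Un image_iff)
  qed (auto simp: \<rho>_rot mult.assoc cis_mult split: prod.splits)
qed

section \<open>Arcs that are graphs over the height, and bigons made of two of them\<close>

definition graph_arc :: "space set \<Rightarrow> real \<Rightarrow> real \<Rightarrow> complex \<Rightarrow> complex \<Rightarrow> bool" where
  "graph_arc S a b P Q \<longleftrightarrow>
     (\<exists>f. continuous_on {a..b} f \<and> S = (\<lambda>u. (f u, u)) ` {a..b} \<and> f a = P \<and> f b = Q)"

lemma graph_arcE:
  assumes "graph_arc S a b P Q"
  obtains f where "continuous_on {a..b} f" "S = (\<lambda>u. (f u, u)) ` {a..b}" "f a = P" "f b = Q"
  using assms unfolding graph_arc_def by (elim exE conjE) (rule that)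

lemma graph_arc_join:
  assumes "graph_arc S a b P Q" "graph_arc T b c Q R" "a \<le> b" "b \<le> c"
  shows "graph_arc (S \<union> T) a c P R"
proof -
  obtain f where f: "continuous_on {a..b} f" "S = (\<lambda>u. (f u, u)) ` {a..b}" "f a = P" "f b = Q"
    using assms(1) by (rule graph_arcE)
  obtain g where g: "continuous_on {b..c} g" "T = (\<lambda>u. (g u, u)) ` {b..c}" "g b = Q" "g c = R"
    using assms(2) by (rule graph_arcE)
  define h where "h u = (if u \<le> b then f u else g u)" for u
  have hf: "h u = f u" if "u \<in> {a..b}" for u
    using that by (simp add: h_def)
  have hg: "h u = g u" if "u \<in> {b..c}" for u
  proof (cases "u = b")
    case True
    then show ?thesis using f(4) g(3) by (simp add: h_def)
  next
    case False
    then show ?thesis using that by (simp add: h_def)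
  qed
  have split: "{a..c} = {a..b} \<union> {b..c}" using assms(3,4) by auto
  have "continuous_on {a..b} h" "continuous_on {b..c} h"
    by (rule continuous_on_eq[OF f(1)] continuous_on_eq[OF g(1)]; simp add: hf hg)+
  then have "continuous_on {a..c} h"
    unfolding split by (intro continuous_on_closed_Un) auto
  moreover have "S = (\<lambda>u. (h u, u)) ` {a..b}" "T = (\<lambda>u. (h u, u)) ` {b..c}"
    unfolding f(2) g(2) by (rule image_cong; simp add: hf hg)+
  then have "S \<union> T = (\<lambda>u. (h u, u)) ` {a..c}"
    unfolding split image_Un by simp
  moreover have "h a = P" "h c = R"
    using hf[of a] hg[of c] assms(3,4) f(3) g(4) by simp_all
  ultimately show ?thesis
    unfolding graph_arc_def by (intro exI[of _ h] conjI)
qed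

lemma isotopic_imp_trivial_knot:
  "isotopic K standard_circle \<Longrightarrow> trivial_knot K"
  unfolding trivial_knot_def by (rule isotopic_imp_ambient_isotopic[OF isotopic_sym])

lemma image_level_graph:
  "(\<lambda>(z, u). (F z u, u)) ` {(p u, u) | u. u \<in> I} = {(F (p u) u, u) | u. u \<in> I}"
  by auto

text \<open>Subtracting \<open>q\<close> turns one arc into the vertical axis, around which
  \<open>p - q\<close> winds. Unwinding leaves only the distance of the arcs, and any distance with
  the same zeros may be replaced by the chord lengths of a circle.\<close>

lemma isotopic_bigon:
  fixes p q :: "real \<Rightarrow> complex"
  assumes p: "continuous_on UNIV p" and q: "continuous_on UNIV q"
    and meet: "\<And>u. p u = q u \<longleftrightarrow> u \<notin> {-1<..<1}"
  shows "isotopic ({(p u, u) | u. u \<in> {-1..1}} \<union> {(q u, u) | u. u \<in> {-1..1}}) standard_circle"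
proof -
  let ?I = "{-1..1::real}"
  \<comment> \<open>The chord length of the unit circle at height \<open>u\<close>, continued by 0
    outside \<open>{-1..1}\<close>.\<close>
  define s where "s u = 2 * sqrt (max 0 (1 - u\<^sup>2))" for u :: real
  have s: "continuous_on UNIV s"
    unfolding s_def by (intro continuous_intros)
  have d: "continuous_on UNIV (\<lambda>u. p u - q u)"
    by (intro continuous_intros p q)
  have d0: "p u - q u = 0 \<longleftrightarrow> u \<notin> {-1<..<1}" for u
    using meet[of u] by simp
  have s0: "s u = 0 \<longleftrightarrow> u \<notin> {-1<..<1}" for u
  proof -
    have "s u = 0 \<longleftrightarrow> 1 \<le> u\<^sup>2" by (simp add: s_def max_def)
    also have "\<dots> \<longleftrightarrow> 1 \<le> \<bar>u\<bar>" using abs_square_less_1[of u] by linarith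
    finally show ?thesis by auto
  qed
  have "isotopic ({(p u, u) | u. u \<in> ?I} \<union> {(q u, u) | u. u \<in> ?I})
      ({(0, u) | u. u \<in> ?I} \<union> {(p u - q u, u) | u. u \<in> ?I})"
  proof -
    have "isotopic A ((\<lambda>(z, u). (exp 0 * z + - q u, u)) ` A)" for A
      by (rule isotopic_levelwise_affine) (intro continuous_intros q)+
    from this[of "{(q u, u) | u. u \<in> ?I} \<union> {(p u, u) | u. u \<in> ?I}"] show ?thesis
      unfolding image_Un image_level_graph by (simp add: Un_commute)
  qed
  also have "isotopic \<dots> ({(0, u) | u. u \<in> ?I} \<union> {(of_real (norm (p u - q u)), u) | u. u \<in> ?I})"
    by (rule isotopic_unwind[OF d d0])
  also (isotopic_trans) have "isotopic \<dots> ({(0, u) | u. u \<in> ?I} \<union> {(of_real (s u), u) | u. u \<in> ?I})"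
  proof (rule isotopic_squeeze)
    show "norm (p u - q u) = 0 \<longleftrightarrow> s u = 0" for u
      unfolding norm_eq_zero d0 s0 ..
    show "0 \<le> s u" for u by (simp add: s_def)
  qed (intro s norm_ge_zero continuous_on_norm[OF d])+
  also (isotopic_trans) have "isotopic \<dots> {(Complex x 0, u) | x u. x\<^sup>2 + u\<^sup>2 = 1}"
  proof -
    \<comment> \<open>Shifting each level by half its chord centres the circle.\<close>
    have eq: "(\<lambda>(z, u). (exp 0 * z + - of_real (s u / 2), u)) `
        ({(0, u) | u. u \<in> ?I} \<union> {(of_real (s u), u) | u. u \<in> ?I}) =
        {(Complex x 0, u) | x u. x\<^sup>2 + u\<^sup>2 = 1}" (is "?L = ?R")
    proof (intro set_eqI iffI)
      fix y assume "y \<in> ?L"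
      then obtain u where u: "u \<in> ?I"
        "y = (exp 0 * 0 + - of_real (s u / 2), u) \<or> y = (exp 0 * of_real (s u) + - of_real (s u / 2), u)"
        by fast
      then have y: "y = (Complex (- (s u / 2)) 0, u) \<or> y = (Complex (s u / 2) 0, u)"
        by (auto simp: complex_eq_iff)
      have "u\<^sup>2 \<le> 1" using u(1) by (simp add: abs_square_le_1 abs_le_iff)
      then have "(s u / 2)\<^sup>2 + u\<^sup>2 = 1" "(- (s u / 2))\<^sup>2 + u\<^sup>2 = 1" by (simp_all add: s_def)
      with y show "y \<in> ?R" by blast
    next
      fix y assume "y \<in> ?R"
      then obtain x u where y: "y = (Complex x 0, u)" "x\<^sup>2 + u\<^sup>2 = 1" by blast
      have "u\<^sup>2 \<le> 1" using y(2) zero_le_power2[of x] by linarith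
      then have u: "u \<in> ?I" by (auto simp: abs_square_le_1)
      have "s u / 2 = \<bar>x\<bar>"
        using y(2) \<open>u\<^sup>2 \<le> 1\<close> by (simp add: s_def flip: real_sqrt_abs)
      then have "y = (exp 0 * 0 + - of_real (s u / 2), u) \<or> y = (exp 0 * of_real (s u) + - of_real (s u / 2), u)"
        using y(1) by (simp add: complex_eq_iff abs_if split: if_splits)
      then show "y \<in> ?L"
        using u by fast
    qed
    have "isotopic A ((\<lambda>(z, u). (exp 0 * z + - of_real (s u / 2), u)) ` A)" for A :: "space set"
      by (rule isotopic_levelwise_affine[of "\<lambda>_. 0" "\<lambda>u. - of_real (s u / 2)"])
         (intro continuous_intros s; simp)+
    then show ?thesis unfolding eq[symmetric] .
  qed
  also (isotopic_trans) note isotopic_tilted_circle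
  finally (isotopic_trans) show ?thesis .
qed

text \<open>Two graphs over the height can only meet at equal levels, so the hypothesis on
  \<open>S \<inter> T\<close> tells where \<open>f\<close> and \<open>g\<close> agree. An affine
  change of height then carries \<open>{a..b}\<close> to \<open>{-1..1}\<close>.\<close>

lemma graph_arc_bigon_isotopic:
  assumes S: "graph_arc S a b P Q" and T: "graph_arc T a b P Q" and "a < b"
    and meet: "S \<inter> T \<subseteq> {(P, a), (Q, b)}"
  shows "isotopic (S \<union> T) standard_circle"
proof -
  obtain f where f: "continuous_on {a..b} f" "S = (\<lambda>u. (f u, u)) ` {a..b}" "f a = P" "f b = Q"
    using S by (rule graph_arcE)
  obtain g where g: "continuous_on {a..b} g" "T = (\<lambda>u. (g u, u)) ` {a..b}" "g a = P" "g b = Q"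
    using T by (rule graph_arcE)
  \<comment> \<open>Clamping continues both arcs constantly beyond their ends, where they agree, as
    \<open>isotopic_bigon\<close> demands of functions on the whole line.\<close>
  define level where "level v = (a + b) / 2 + max (-1) (min 1 v) * ((b - a) / 2)" for v
  define \<alpha> where "\<alpha> u = (2 * u - a - b) / (b - a)" for u
  have level_in: "level v \<in> {a..b}" for v
  proof -
    have "\<bar>max (-1) (min 1 v) * ((b - a) / 2)\<bar> \<le> 1 * ((b - a) / 2)"
      unfolding abs_mult using \<open>a < b\<close> by (intro mult_mono) auto
    then show ?thesis unfolding level_def atLeastAtMost_iff abs_le_iff by (simp add: field_simps)
  qed
  have level_\<alpha>: "level (\<alpha> u) = u" "\<alpha> u \<in> {-1..1}" if "u \<in> {a..b}" for u
  proof -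
    show "\<alpha> u \<in> {-1..1}" using that \<open>a < b\<close> by (auto simp: \<alpha>_def field_simps)
    then have "max (-1) (min 1 (\<alpha> u)) = \<alpha> u" by simp
    moreover have "\<alpha> u * (b - a) = 2 * u - a - b" using \<open>a < b\<close> by (simp add: \<alpha>_def)
    ultimately have "level (\<alpha> u) = (a + b) / 2 + (2 * u - a - b) / 2" by (simp add: level_def)
    then show "level (\<alpha> u) = u" by (simp add: field_simps)
  qed
  have \<alpha>_level: "\<alpha> (level v) = v" if "v \<in> {-1..1}" for v
    using that \<open>a < b\<close> by (simp add: level_def \<alpha>_def field_simps)
  have cont: "continuous_on UNIV (\<lambda>v. h (level v))" if "continuous_on {a..b} h" for h :: "real \<Rightarrow> complex"
  proof (rule continuous_on_compose2[OF that])
    show "continuous_on UNIV level" unfolding level_def by (intro continuous_intros)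
  qed (use level_in in auto)
  have ends: "level v = a \<or> level v = b \<longleftrightarrow> v \<notin> {-1<..<1}" for v
  proof -
    have "level v - a = (max (-1) (min 1 v) + 1) * ((b - a) / 2)"
      "level v - b = (max (-1) (min 1 v) - 1) * ((b - a) / 2)"
      by (simp_all add: level_def algebra_simps) (simp_all add: field_simps)
    then have "level v = a \<longleftrightarrow> max (-1) (min 1 v) = -1" "level v = b \<longleftrightarrow> max (-1) (min 1 v) = 1"
      using \<open>a < b\<close> by (smt (verit) divide_pos_pos mult_eq_0_iff)+
    then show ?thesis by (auto simp: max_def min_def)
  qed
  have "f (level v) = g (level v) \<longleftrightarrow> level v = a \<or> level v = b" for v
  proof
    assume "f (level v) = g (level v)"
    moreover have "(f (level v), level v) \<in> S" "(g (level v), level v) \<in> T"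
      using level_in[of v] unfolding f(2) g(2) by blast+
    ultimately have "(f (level v), level v) \<in> S \<inter> T"
      by simp
    then show "level v = a \<or> level v = b" using meet by auto
  qed (use f(3,4) g(3,4) in auto)
  then have bigon: "isotopic ({(f (level v), v) | v. v \<in> {-1..1}} \<union> {(g (level v), v) | v. v \<in> {-1..1}}) standard_circle"
    using isotopic_bigon[OF cont[OF f(1)] cont[OF g(1)]] ends by auto
  \<comment> \<open>The factor \<open>2 / (b - a)\<close> is positive and thus an exponential, so
    the change of height is one of the fibrewise affine motions.\<close>
  have scale: "exp (ln (2 / (b - a))) * u + - (a + b) / (b - a) = \<alpha> u" for u
    using \<open>a < b\<close> by (simp add: \<alpha>_def diff_divide_distrib add_divide_distrib)
  have "(\<lambda>(z, u). (z, \<alpha> u)) ` (\<lambda>u. (h u, u)) ` {a..b} = {(h (level v), v) | v. v \<in> {-1..1}}" for h :: "real \<Rightarrow> complex"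
  proof (intro set_eqI iffI)
    fix y assume "y \<in> (\<lambda>(z, u). (z, \<alpha> u)) ` (\<lambda>u. (h u, u)) ` {a..b}"
    then obtain u where "u \<in> {a..b}" "y = (h u, \<alpha> u)" by auto
    then show "y \<in> {(h (level v), v) | v. v \<in> {-1..1}}" using level_\<alpha>[of u] by force
  next
    fix y assume "y \<in> {(h (level v), v) | v. v \<in> {-1..1}}"
    then obtain v where "v \<in> {-1..1}" "y = (h (level v), v)" by auto
    then show "y \<in> (\<lambda>(z, u). (z, \<alpha> u)) ` (\<lambda>u. (h u, u)) ` {a..b}"
      using \<alpha>_level[of v] level_in[of v] by (auto simp: image_image intro!: image_eqI[of _ _ "level v"])
  qed
  then have "(\<lambda>(z, u). (z, \<alpha> u)) ` (S \<union> T) =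
      {(f (level v), v) | v. v \<in> {-1..1}} \<union> {(g (level v), v) | v. v \<in> {-1..1}}"
    unfolding f(2) g(2) image_Un by simp
  then have "isotopic ((\<lambda>(z, u). (z, \<alpha> u)) ` (S \<union> T)) standard_circle"
    using bigon by (simp only:)
  moreover have "isotopic (S \<union> T) ((\<lambda>(z, u). (z, \<alpha> u)) ` (S \<union> T))"
    using isotopic_fibrewise_affine[of "\<lambda>_. ln (2 / (b - a))" "\<lambda>_. - (a + b) / (b - a)" "S \<union> T"]
    unfolding scale by simp
  ultimately show ?thesis
    by (rule isotopic_trans[rotated])
qed

section \<open>Lifts of a drawing\<close>

lemma mem_drawn_Blade: "z \<in> drawn (Blade i) \<longleftrightarrow> Im z = real i \<and> 0 \<le> Re z \<and> Re z \<le> 1"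
  by (auto simp: closed_segment_def complex_eq_iff algebra_simps)

lemma mem_drawn_LeftTie:
  assumes "i < j"
  shows "z \<in> drawn (LeftTie (i, j)) \<longleftrightarrow> Re z \<le> 0 \<and> (Re z)\<^sup>2 = (Im z - real i) * (real j - Im z)"
  using semicircle_iff[of "real i" "real j" "Re z" "Im z" 0] assms by simp

lemma mem_drawn_RightTie:
  assumes "i < j"
  shows "z \<in> drawn (RightTie (i, j)) \<longleftrightarrow> 1 \<le> Re z \<and> (Re z - 1)\<^sup>2 = (Im z - real i) * (real j - Im z)"
  using semicircle_iff[of "real i" "real j" "Re z" "Im z" 1] assms by simp

lemma closed_drawn: "closed (drawn s)"
proof (cases s)
  case (LeftTie e)
  then show ?thesis
    by (cases e) (auto intro!: closed_Collect_conj closed_Collect_le closed_Collect_eq continuous_intros)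
next
  case (RightTie e)
  then show ?thesis
    by (cases e) (auto intro!: closed_Collect_conj closed_Collect_le closed_Collect_eq continuous_intros)
qed simp

lemma semicircle_range:
  fixes a b x y :: real
  assumes "a < b" "x\<^sup>2 = (y - a) * (b - y)"
  shows "a \<le> y" "y \<le> b"
proof -
  have "0 \<le> (y - a) * (b - y)" using assms(2) zero_le_power2[of x] by simp
  then show "a \<le> y" "y \<le> b" using assms(1) by (auto simp: zero_le_mult_iff)
qed

text \<open>The last condition excludes triple points of the drawing.\<close>

definition tying_pattern :: "pattern \<Rightarrow> bool" where
  "tying_pattern X \<longleftrightarrow> finite X \<and> (\<forall>(i, j)\<in>X. i < j) \<and>
     (\<forall>(i, j)\<in>X. \<forall>(k, l)\<in>X. (i, j) \<noteq> (k, l) \<longrightarrow> i \<noteq> k \<and> i \<noteq> l \<and> j \<noteq> k \<and> j \<noteq> l) \<and>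
     (\<forall>e\<in>X. \<forall>f\<in>X. \<forall>g\<in>X. \<not> (interleave e f \<and> interleave e g \<and> interleave f g))"

lemma tying_patternD:
  assumes "tying_pattern X"
  shows "finite X"
    and "(i, j) \<in> X \<Longrightarrow> i < j"
    and "(i, j) \<in> X \<Longrightarrow> (k, l) \<in> X \<Longrightarrow> (i, j) \<noteq> (k, l) \<Longrightarrow> i \<noteq> k \<and> i \<noteq> l \<and> j \<noteq> k \<and> j \<noteq> l"
    and "e \<in> X \<Longrightarrow> f \<in> X \<Longrightarrow> g \<in> X \<Longrightarrow> \<not> (interleave e f \<and> interleave e g \<and> interleave f g)"
  using assms unfolding tying_pattern_def by fast+

lemma interleave_sym: "interleave e f \<longleftrightarrow> interleave f e"
  by (cases e; cases f) auto

lemma crosses_sym: "crosses s t \<longleftrightarrow> crosses t s"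
  by (cases s; cases t) (simp_all add: interleave_sym)

lemma finite_strands: "tying_pattern X \<Longrightarrow> tying_pattern Y \<Longrightarrow> finite (strands X Y)"
  by (simp add: strands_def tying_pattern_def)

section \<open>Where the strands of a drawing meet\<close>

lemma pattern_ties_meet:
  assumes "tying_pattern X" "e \<in> X" "f \<in> X" "e \<noteq> f" "tie = LeftTie \<or> tie = RightTie"
  shows "if interleave e f then \<exists>p. drawn (tie e) \<inter> drawn (tie f) = {p}
         else drawn (tie e) \<inter> drawn (tie f) = {}"
proof -
  obtain i j k l where ef: "e = (i, j)" "f = (k, l)" by (cases e; cases f)
  show ?thesis
    unfolding ef
    by (rule ties_meet) (use tying_patternD(2)[OF assms(1)] tying_patternD(3)[OF assms(1), of i j k l] assms(2-5) ef in auto)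
qed

lemma ties_meet_interleave:
  assumes "tying_pattern X" "e \<in> X" "f \<in> X" "e \<noteq> f" "tie = LeftTie \<or> tie = RightTie"
    and "p \<in> drawn (tie e)" "p \<in> drawn (tie f)"
  shows "interleave e f"
proof (rule ccontr)
  assume "\<not> interleave e f"
  then have "drawn (tie e) \<inter> drawn (tie f) = {}"
    using pattern_ties_meet[OF assms(1-5)] by (simp only: if_False)
  then show False using assms(6,7) by blast
qed

lemma blade_tie_meet:
  assumes "i < j"
  shows "p \<in> drawn (Blade k) \<Longrightarrow> p \<in> drawn (LeftTie (i, j)) \<Longrightarrow> Re p = 0 \<and> Im p = real k \<and> (k = i \<or> k = j)"
    and "p \<in> drawn (Blade k) \<Longrightarrow> p \<in> drawn (RightTie (i, j)) \<Longrightarrow> Re p = 1 \<and> Im p = real k \<and> (k = i \<or> k = j)"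
  unfolding mem_drawn_Blade mem_drawn_LeftTie[OF assms] mem_drawn_RightTie[OF assms] by auto

lemma left_right_disjoint:
  assumes "tying_pattern X" "tying_pattern Y" "e \<in> X" "f \<in> Y"
  shows "drawn (LeftTie e) \<inter> drawn (RightTie f) = {}"
  by (cases e; cases f) auto

lemma strandsE:
  assumes "s \<in> strands X Y"
  obtains i where "s = Blade i" | e where "s = LeftTie e" "e \<in> X" | e where "s = RightTie e" "e \<in> Y"
  using assms unfolding strands_def by blast

text \<open>A third tie on the same side would cross both others, which \<open>tying_pattern\<close>
  forbids. A blade meets ties only at their ends, and two crossing ties share no end. Ties of the
  other side lie beyond the strip of the blades.\<close>

lemma no_triple_point:
  assumes X: "tying_pattern X" and Y: "tying_pattern Y"
    and st: "s \<in> strands X Y" "t \<in> strands X Y" "crosses s t" "p \<in> drawn s" "p \<in> drawn t"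
    and u: "u \<in> strands X Y" "p \<in> drawn u"
  shows "u = s \<or> u = t"
proof (rule ccontr)
  assume neq: "\<not> ?thesis"
  have *: False
    if Z: "tying_pattern Z" and tie: "tie = LeftTie \<or> tie = RightTie"
      and ef: "s = tie e" "t = tie f" "e \<in> Z" "f \<in> Z" "interleave e f"
      and u': "u = tie g \<and> g \<in> Z \<or> (\<exists>k. u = Blade k)"
    for Z tie e f g
    using u'
  proof
    assume g: "u = tie g \<and> g \<in> Z"
    then have "e \<noteq> g" "f \<noteq> g" using neq ef(1,2) by auto
    then have "interleave e g" "interleave f g"
      using ties_meet_interleave[OF Z ef(3) conjunct2[OF g] _ tie, of p] ties_meet_interleave[OF Z ef(4) conjunct2[OF g] _ tie, of p]
        ef(1,2) st(4,5) u(2) g by blast+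
    then show False using tying_patternD(4)[OF Z] ef(3-5) g by blast
  next
    assume "\<exists>k. u = Blade k"
    then obtain k where k: "u = Blade k" ..
    obtain a b c d where ab: "e = (a, b)" and cd: "f = (c, d)" by (cases e; cases f)
    have lt: "a < b" "c < d" using tying_patternD(2)[OF Z] ef(3,4) unfolding ab cd by blast+
    have p: "p \<in> drawn (Blade k)" "p \<in> drawn (tie (a, b))" "p \<in> drawn (tie (c, d))"
      using st(4,5) u(2) unfolding ef(1,2) k ab cd by blast+
    have "k = a \<or> k = b" "k = c \<or> k = d"
      using tie blade_tie_meet[OF lt(1) p(1)] blade_tie_meet[OF lt(2) p(1)] p(2,3) by blast+
    moreover have "e \<noteq> f" using ef(5) by (cases e) auto
    ultimately show False
      using tying_patternD(3)[OF Z ef(3,4)[unfolded ab cd]] unfolding ab cd by blast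
  qed
  from st(3) consider e f where "s = LeftTie e" "t = LeftTie f" "interleave e f"
    | e f where "s = RightTie e" "t = RightTie f" "interleave e f"
    by (cases s; cases t) auto
  then show False
  proof cases
    case 1
    then have ef: "e \<in> X" "f \<in> X" using st(1,2) by (auto elim: strandsE)
    show ?thesis
      using u(1)
    proof (cases rule: strandsE)
      case (3 g)
      then show ?thesis using left_right_disjoint[OF X Y ef(1), of g] st(4) u(2) 1(1) by blast
    qed (use *[OF X _ 1(1,2) ef 1(3)] in blast)+
  next
    case 2
    then have ef: "e \<in> Y" "f \<in> Y" using st(1,2) by (auto elim: strandsE)
    show ?thesis
      using u(1)
    proof (cases rule: strandsE)
      case (2 g)
      then show ?thesis using left_right_disjoint[OF X Y _ ef(1), of g] st(4) u(2) \<open>s = RightTie e\<close> by blast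
    qed (use *[OF Y _ 2(1,2) ef 2(3)] in blast)+
  qed
qed

text \<open>Finiteness makes the crossing points a closed discrete set, so values prescribed there
  extend continuously to the plane.\<close>

lemma finite_crossing_points:
  assumes X: "tying_pattern X" and Y: "tying_pattern Y"
  shows "finite {p. \<exists>s\<in>strands X Y. \<exists>t\<in>strands X Y. crosses s t \<and> p \<in> drawn s \<and> p \<in> drawn t}"
proof -
  have "finite (drawn s \<inter> drawn t)" if "s \<in> strands X Y" "t \<in> strands X Y" "crosses s t" for s t
  proof -
    have *: "finite (drawn (tie e) \<inter> drawn (tie f))"
      if Z: "tying_pattern Z" "e \<in> Z" "f \<in> Z" and "interleave e f" "tie = LeftTie \<or> tie = RightTie"
      for Z tie e f
    proof -
      have "e \<noteq> f" using \<open>interleave e f\<close> by (cases e) auto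
      from pattern_ties_meet[OF Z this that(5)] have "\<exists>p. drawn (tie e) \<inter> drawn (tie f) = {p}"
        using \<open>interleave e f\<close> by (simp only: if_True)
      then show ?thesis by (elim exE) (simp only: finite.intros)
    qed
    from that show ?thesis
      using *[OF X, where tie = LeftTie] *[OF Y, where tie = RightTie]
      by (cases s; cases t) (auto simp: strands_def simp del: drawn.simps)
  qed
  then have "finite (\<Union>s\<in>strands X Y. \<Union>t\<in>{t\<in>strands X Y. crosses s t}. drawn s \<inter> drawn t)"
    using finite_strands[OF X Y] by (simp del: UN_simps)
  moreover have "{p. \<exists>s\<in>strands X Y. \<exists>t\<in>strands X Y. crosses s t \<and> p \<in> drawn s \<and> p \<in> drawn t}
      \<subseteq> (\<Union>s\<in>strands X Y. \<Union>t\<in>{t\<in>strands X Y. crosses s t}. drawn s \<inter> drawn t)"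
    by auto
  ultimately show ?thesis by (rule rev_finite_subset)
qed

text \<open>Rescaling the height by a factor that depends on the base point gives the two lifts the same
  gap at each crossing; what then remains is a difference of heights that is a well-defined
  function on the plane curve.\<close>

lemma has_diagram_unique:
  assumes X: "tying_pattern X" and Y: "tying_pattern Y"
    and over: "crossing_choice X Y over"
    and K: "has_diagram X Y over K" and K': "has_diagram X Y over K'"
  shows "isotopic K K'"
proof -
  let ?St = "strands X Y"
  have fin: "finite ?St" by (rule finite_strands[OF X Y])
  from K obtain h where h_cont: "\<forall>s\<in>?St. continuous_on (drawn s) (h s)"
    and h_meet: "\<forall>s\<in>?St. \<forall>t\<in>?St. \<forall>p\<in>drawn s \<inter> drawn t.
       if crosses s t then over s t \<longrightarrow> h t p < h s p else h s p = h t p"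
    and K_eq: "K = {(p, h s p) | s p. s \<in> ?St \<and> p \<in> drawn s}"
    unfolding has_diagram_def by (elim exE conjE)
  have h_above: "h t p < h s p" if "s \<in> ?St" "t \<in> ?St" "p \<in> drawn s" "p \<in> drawn t" "crosses s t" "over s t" for s t p
    using h_meet[THEN bspec, THEN bspec, THEN bspec, OF that(1,2) IntI[OF that(3,4)]] that(5,6) by (simp only: if_True simp_thms)
  have h_agree: "h s p = h t p" if "s \<in> ?St" "t \<in> ?St" "p \<in> drawn s" "p \<in> drawn t" "\<not> crosses s t" for s t p
    using h_meet[THEN bspec, THEN bspec, THEN bspec, OF that(1,2) IntI[OF that(3,4)]] that(5) by (simp only: if_False)
  from K' obtain h' where h'_cont: "\<forall>s\<in>?St. continuous_on (drawn s) (h' s)"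
    and h'_meet: "\<forall>s\<in>?St. \<forall>t\<in>?St. \<forall>p\<in>drawn s \<inter> drawn t.
       if crosses s t then over s t \<longrightarrow> h' t p < h' s p else h' s p = h' t p"
    and K'_eq: "K' = {(p, h' s p) | s p. s \<in> ?St \<and> p \<in> drawn s}"
    unfolding has_diagram_def by (elim exE conjE)
  have h'_above: "h' t p < h' s p" if "s \<in> ?St" "t \<in> ?St" "p \<in> drawn s" "p \<in> drawn t" "crosses s t" "over s t" for s t p
    using h'_meet[THEN bspec, THEN bspec, THEN bspec, OF that(1,2) IntI[OF that(3,4)]] that(5,6) by (simp only: if_True simp_thms)
  have h'_agree: "h' s p = h' t p" if "s \<in> ?St" "t \<in> ?St" "p \<in> drawn s" "p \<in> drawn t" "\<not> crosses s t" for s t p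
    using h'_meet[THEN bspec, THEN bspec, THEN bspec, OF that(1,2) IntI[OF that(3,4)]] that(5) by (simp only: if_False)
  define crossing where "crossing s t p \<longleftrightarrow> s \<in> ?St \<and> t \<in> ?St \<and> crosses s t \<and> p \<in> drawn s \<and> p \<in> drawn t" for s t p
  define gap where "gap s t p = (h' s p - h' t p) / (h s p - h t p)" for s t p
  \<comment> \<open>Both lifts put the same strand on top, so the two height differences have the
    same sign and their ratio has a logarithm.\<close>
  have gap_pos: "0 < gap s t p" and gap_nz: "h s p - h t p \<noteq> 0" if "crossing s t p" for s t p
  proof -
    from that have c: "s \<in> ?St" "t \<in> ?St" "crosses s t" "crosses t s" "p \<in> drawn s" "p \<in> drawn t"
      by (simp_all add: crossing_def crosses_sym)
    then have "over s t \<or> over t s"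
      using over unfolding crossing_choice_def by blast
    then have "h t p < h s p \<and> h' t p < h' s p \<or> h s p < h t p \<and> h' s p < h' t p"
      using h_above[OF c(1,2,5,6,3)] h_above[OF c(2,1,6,5,4)] h'_above[OF c(1,2,5,6,3)] h'_above[OF c(2,1,6,5,4)] by blast
    then show "0 < gap s t p" "h s p - h t p \<noteq> 0"
      by (auto simp: gap_def divide_neg_neg)
  qed
  have gap_sym: "gap s t p = gap t s p" for s t p
    unfolding gap_def by (metis minus_diff_eq minus_divide_divide)
  \<comment> \<open>Without triple points a crossing point determines its two strands up to
    order.\<close>
  have gap_unique: "gap s t p = gap s' t' p" if "crossing s t p" "crossing s' t' p" for s t s' t' p
  proof -
    have "s' = s \<or> s' = t" "t' = s \<or> t' = t"
      using no_triple_point[OF X Y, of s t p] that unfolding crossing_def by metis+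
    moreover have "s' \<noteq> t'" using that(2) unfolding crossing_def by (cases s'; cases t') auto
    ultimately show ?thesis using gap_sym by metis
  qed
  define P where "P = {p. \<exists>s t. crossing s t p}"
  define gap_at where "gap_at p = (SOME g. \<exists>s t. crossing s t p \<and> g = gap s t p)" for p
  have gap_at: "gap_at p = gap s t p" if "crossing s t p" for s t p
    unfolding gap_at_def using that gap_unique by (intro some_equality) blast+
  have "finite P"
    using finite_crossing_points[OF X Y] unfolding P_def crossing_def
    by (rule rev_finite_subset) blast
  then obtain l where l: "continuous_on UNIV l" "\<And>p. p \<in> P \<Longrightarrow> l p = ln (gap_at p)"
    using Tietze_unbounded[of P "\<lambda>p. ln (gap_at p)" UNIV] continuous_on_finite finite_imp_closed
    by (metis closed_closedin subtopology_UNIV)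
  have exp_l: "exp (l p) = gap s t p" if "crossing s t p" for s t p
  proof -
    have "p \<in> P" using that unfolding P_def by blast
    then show ?thesis using l(2)[of p] gap_at[OF that] gap_pos[OF that] by simp
  qed
  \<comment> \<open>The discrepancy left after rescaling. At a crossing the gaps now coincide, and
    elsewhere strands that meet have equal heights in each lift; so its value at a point does not
    depend on the strand.\<close>
  define diff where "diff s p = h' s p - exp (l p) * h s p" for s p
  have diff_eq: "diff s p = diff t p" if "s \<in> ?St" "t \<in> ?St" "p \<in> drawn s" "p \<in> drawn t" for s t p
  proof (cases "crosses s t")
    case True
    then have c: "crossing s t p" using that by (simp add: crossing_def)
    have "exp (l p) * (h s p - h t p) = h' s p - h' t p"
      using exp_l[OF c] gap_nz[OF c] by (simp add: gap_def)
    then show ?thesis by (simp add: diff_def algebra_simps)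
  next
    case False
    then show ?thesis using h_agree[OF that] h'_agree[OF that] by (simp add: diff_def)
  qed
  define d0 where "d0 p = diff (SOME s. s \<in> ?St \<and> p \<in> drawn s) p" for p
  have d0: "d0 p = diff s p" if "s \<in> ?St" "p \<in> drawn s" for s p
  proof -
    have "(SOME s. s \<in> ?St \<and> p \<in> drawn s) \<in> ?St \<and> p \<in> drawn (SOME s. s \<in> ?St \<and> p \<in> drawn s)"
      using that by (intro someI[of "\<lambda>s. s \<in> ?St \<and> p \<in> drawn s"]) auto
    then show ?thesis unfolding d0_def using that diff_eq by blast
  qed
  have "continuous_on (drawn s) (diff s)" if "s \<in> ?St" for s
    unfolding diff_def
    by (intro continuous_intros h_cont[THEN bspec] h'_cont[THEN bspec] that continuous_on_subset[OF l(1)]) auto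
  \<comment> \<open>Finitely many closed strands make up the drawing, so continuity on each of them
    gives continuity on the union, and Tietze extends the shift to the plane.\<close>
  then have "continuous_on (drawn s) d0" if "s \<in> ?St" for s
    by (rule continuous_on_eq) (use that d0 in auto)
  then have "continuous_on (\<Union>s\<in>?St. drawn s) d0"
    by (intro continuous_on_closed_Union fin closed_drawn)
  moreover have "closed (\<Union>s\<in>?St. drawn s)"
    using fin closed_drawn by blast
  ultimately obtain d where d: "continuous_on UNIV d" "\<And>p. p \<in> (\<Union>s\<in>?St. drawn s) \<Longrightarrow> d p = d0 p"
    using Tietze_unbounded[of "\<Union>s\<in>?St. drawn s" d0 UNIV] by (metis closed_closedin subtopology_UNIV)
  have move: "exp (l p) * h s p + d p = h' s p" if "s \<in> ?St" "p \<in> drawn s" for s p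
  proof -
    have "p \<in> (\<Union>s\<in>?St. drawn s)" using that by (rule UN_I)
    then have "d p = diff s p" using d(2)[of p] d0[OF that] by simp
    then show ?thesis by (simp add: diff_def)
  qed
  have "(\<lambda>(z, u). (z, exp (l z) * u + d z)) ` K = {(p, exp (l p) * h s p + d p) | s p. s \<in> ?St \<and> p \<in> drawn s}"
    unfolding K_eq by (auto simp: image_iff simp del: drawn.simps)
  also have "\<dots> = K'"
    unfolding K'_eq using move by (intro Collect_cong) metis
  finally have "(\<lambda>(z, u). (z, exp (l z) * u + d z)) ` K = K'" .
  then show ?thesis
    using isotopic_fibrewise_affine[OF l(1) d(1), of K] by simp
qed

section \<open>Lifts with prescribed heights at the blade ends\<close>

text \<open>\<open>l\<close> and \<open>r\<close> prescribe heights at the left and right ends of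
  the blades only. A semicircle is parametrised injectively by the imaginary part, so the height
  along a tie is taken affine in it.\<close>

fun interpolate :: "(nat \<Rightarrow> real) \<Rightarrow> (nat \<Rightarrow> real) \<Rightarrow> strand \<Rightarrow> complex \<Rightarrow> real" where
  "interpolate l r (Blade i) z = l i + (r i - l i) * Re z"
| "interpolate l r (LeftTie (i, j)) z = l i + (l j - l i) * ((Im z - real i) / (real j - real i))"
| "interpolate l r (RightTie (i, j)) z = r i + (r j - r i) * ((Im z - real i) / (real j - real i))"

definition lift :: "(nat \<Rightarrow> real) \<Rightarrow> (nat \<Rightarrow> real) \<Rightarrow> strand \<Rightarrow> space set" where
  "lift l r s = {(p, interpolate l r s p) | p. p \<in> drawn s}"

lemma interleave_irrefl: "\<not> interleave e e"
  by (cases e) auto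

lemma convex_combination_bounds:
  fixes a b x y t :: real
  assumes "a \<le> t" "t \<le> b" "a < b"
  shows "min x y \<le> x + (y - x) * ((t - a) / (b - a))" "x + (y - x) * ((t - a) / (b - a)) \<le> max x y"
proof -
  define c where "c = (t - a) / (b - a)"
  have c: "0 \<le> c" "c \<le> 1" using assms by (simp_all add: c_def)
  have "x + (y - x) * c = (1 - c) * x + c * y" by (simp add: algebra_simps)
  moreover have "(1 - c) * min x y + c * min x y \<le> (1 - c) * x + c * y"
    using c by (intro add_mono mult_left_mono) auto
  moreover have "(1 - c) * x + c * y \<le> (1 - c) * max x y + c * max x y"
    using c by (intro add_mono mult_left_mono) auto
  ultimately show "min x y \<le> x + (y - x) * ((t - a) / (b - a))" "x + (y - x) * ((t - a) / (b - a)) \<le> max x y"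
    by (simp_all add: c_def[symmetric] algebra_simps)
qed

lemma interpolate_tie_bounds:
  assumes "i < j"
  shows "p \<in> drawn (LeftTie (i, j)) \<Longrightarrow>
      min (l i) (l j) \<le> interpolate l r (LeftTie (i, j)) p \<and> interpolate l r (LeftTie (i, j)) p \<le> max (l i) (l j)"
    and "p \<in> drawn (RightTie (i, j)) \<Longrightarrow>
      min (r i) (r j) \<le> interpolate l r (RightTie (i, j)) p \<and> interpolate l r (RightTie (i, j)) p \<le> max (r i) (r j)"
proof -
  have ij: "real i < real j" using assms by simp
  note range = semicircle_range[OF ij] and bounds = convex_combination_bounds[OF _ _ ij]
  show "min (l i) (l j) \<le> interpolate l r (LeftTie (i, j)) p \<and> interpolate l r (LeftTie (i, j)) p \<le> max (l i) (l j)"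
    if "p \<in> drawn (LeftTie (i, j))"
    using range[of "Re p" "Im p"] bounds[of "Im p"] that
    unfolding mem_drawn_LeftTie[OF assms] interpolate.simps by blast
  show "min (r i) (r j) \<le> interpolate l r (RightTie (i, j)) p \<and> interpolate l r (RightTie (i, j)) p \<le> max (r i) (r j)"
    if "p \<in> drawn (RightTie (i, j))"
    using range[of "Re p - 1" "Im p"] bounds[of "Im p"] that
    unfolding mem_drawn_RightTie[OF assms] interpolate.simps by blast
qed

lemma continuous_on_interpolate: "continuous_on S (interpolate l r s)"
proof (cases s)
  case (Blade i)
  then show ?thesis by (auto intro!: continuous_intros)
next
  case (LeftTie e)
  then show ?thesis by (cases e) (simp add: divide_inverse, intro continuous_intros)
next
  case (RightTie e)
  then show ?thesis by (cases e) (simp add: divide_inverse, intro continuous_intros)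
qed

text \<open>Along a tie the height stays between the heights of its two ends. Crossing ties whose
  ends occupy separate ranges are therefore in the right order, wherever the crossing point
  lies.\<close>

lemma has_diagram_lift:
  assumes X: "tying_pattern X" and Y: "tying_pattern Y"
    and left: "\<And>e f. e \<in> X \<Longrightarrow> f \<in> X \<Longrightarrow> interleave e f \<Longrightarrow> over (LeftTie e) (LeftTie f) \<Longrightarrow>
      max (l (fst f)) (l (snd f)) < min (l (fst e)) (l (snd e))"
    and right: "\<And>e f. e \<in> Y \<Longrightarrow> f \<in> Y \<Longrightarrow> interleave e f \<Longrightarrow> over (RightTie e) (RightTie f) \<Longrightarrow>
      max (r (fst f)) (r (snd f)) < min (r (fst e)) (r (snd e))"
  shows "has_diagram X Y over (\<Union>s\<in>strands X Y. lift l r s)"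
proof -
  have blade_tie: "interpolate l r (Blade i) p = interpolate l r t p"
    if "t \<in> strands X Y" "p \<in> drawn (Blade i)" "p \<in> drawn t" for i t p
    using that(1)
  proof (cases rule: strandsE)
    case (1 j)
    then show ?thesis using that(2,3) unfolding 1 mem_drawn_Blade by simp
  next
    case (2 e)
    obtain j k where e: "e = (j, k)" by (cases e)
    have lt: "j < k" using tying_patternD(2)[OF X] 2(2) unfolding e .
    show ?thesis
      using blade_tie_meet(1)[OF lt that(2)] that(3) lt unfolding 2(1) e by (auto simp del: drawn.simps)
  next
    case (3 e)
    obtain j k where e: "e = (j, k)" by (cases e)
    have lt: "j < k" using tying_patternD(2)[OF Y] 3(2) unfolding e .
    show ?thesis
      using blade_tie_meet(2)[OF lt that(2)] that(3) lt unfolding 3(1) e by (auto simp del: drawn.simps)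
  qed
  have main: "if crosses s t then over s t \<longrightarrow> interpolate l r t p < interpolate l r s p
      else interpolate l r s p = interpolate l r t p"
    if st: "s \<in> strands X Y" "t \<in> strands X Y" and p: "p \<in> drawn s" "p \<in> drawn t" for s t p
    using st(1)
  proof (cases rule: strandsE)
    case (1 i)
    then show ?thesis using blade_tie[OF st(2), of p i] p by simp
  next
    case (2 e)
    show ?thesis
      using st(2)
    proof (cases rule: strandsE)
      case (1 i)
      then show ?thesis using blade_tie[OF st(1), of p i] p by simp
    next
      case f: (2 f)
      show ?thesis
      proof (cases "e = f")
        case True
        then show ?thesis using 2 f by (simp add: interleave_irrefl)
      next
        case False
        obtain i j k m where ef: "e = (i, j)" "f = (k, m)" by (cases e; cases f)
        have lt: "i < j" "k < m" using tying_patternD(2)[OF X] 2(2) f(2) unfolding ef by blast+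
        have il: "interleave e f"
          by (rule ties_meet_interleave[OF X 2(2) f(2) False, of LeftTie p]) (use p 2 f in blast)+
        have "over s t \<longrightarrow> interpolate l r t p < interpolate l r s p"
        proof
          assume "over s t"
          then have "max (l k) (l m) < min (l i) (l j)"
            using left[of e f] 2 f il unfolding ef by simp
          then show "interpolate l r t p < interpolate l r s p"
            using interpolate_tie_bounds(1)[OF lt(1), of p l r] interpolate_tie_bounds(1)[OF lt(2), of p l r] p
            unfolding 2(1) f(1) ef by linarith
        qed
        then show ?thesis using il by (simp only: 2(1) f(1) crosses.simps if_True)
      qed
    next
      case (3 f)
      then show ?thesis using left_right_disjoint[OF X Y 2(2), of f] p 2 by blast
    qed
  next
    case (3 e)
    show ?thesis
      using st(2)
    proof (cases rule: strandsE)
      case (1 i)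
      then show ?thesis using blade_tie[OF st(1), of p i] p by simp
    next
      case (2 f)
      then show ?thesis using left_right_disjoint[OF X Y _ 3(2), of f] p 3 by blast
    next
      case f: (3 f)
      show ?thesis
      proof (cases "e = f")
        case True
        then show ?thesis using 3 f by (simp add: interleave_irrefl)
      next
        case False
        obtain i j k m where ef: "e = (i, j)" "f = (k, m)" by (cases e; cases f)
        have lt: "i < j" "k < m" using tying_patternD(2)[OF Y] 3(2) f(2) unfolding ef by blast+
        have il: "interleave e f"
          by (rule ties_meet_interleave[OF Y 3(2) f(2) False, of RightTie p]) (use p 3 f in blast)+
        have "over s t \<longrightarrow> interpolate l r t p < interpolate l r s p"
        proof
          assume "over s t"
          then have "max (r k) (r m) < min (r i) (r j)"
            using right[of e f] 3 f il unfolding ef by simp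
          then show "interpolate l r t p < interpolate l r s p"
            using interpolate_tie_bounds(2)[OF lt(1), of p r l] interpolate_tie_bounds(2)[OF lt(2), of p r l] p
            unfolding 3(1) f(1) ef by linarith
        qed
        then show ?thesis using il by (simp only: 3(1) f(1) crosses.simps if_True)
      qed
    qed
  qed
  show ?thesis
    unfolding has_diagram_def
  proof (intro exI[of _ "interpolate l r"] conjI ballI)
    show "(\<Union>s\<in>strands X Y. lift l r s) = {(p, interpolate l r s p) | s p. s \<in> strands X Y \<and> p \<in> drawn s}"
      unfolding lift_def by blast
  qed (use main in \<open>blast intro: continuous_on_interpolate\<close>)+
qed

text \<open>Where the height grows at constant rate along a path, it can itself serve as the
  parameter.\<close>

lemma graph_arcI_path:
  fixes \<gamma> :: "real \<Rightarrow> complex"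
  assumes "\<alpha> < \<beta>" "continuous_on {0..1} \<gamma>" "\<gamma> ` {0..1} = D"
    and height: "\<And>t. t \<in> {0..1} \<Longrightarrow> H (\<gamma> t) = \<alpha> + (\<beta> - \<alpha>) * t"
  shows "graph_arc {(p, H p) | p. p \<in> D} \<alpha> \<beta> (\<gamma> 0) (\<gamma> 1)"
  unfolding graph_arc_def
proof (intro exI[of _ "\<lambda>u. \<gamma> ((u - \<alpha>) / (\<beta> - \<alpha>))"] conjI)
  have in01: "(u - \<alpha>) / (\<beta> - \<alpha>) \<in> {0..1}" if "u \<in> {\<alpha>..\<beta>}" for u
    using that assms(1) by simp
  show "continuous_on {\<alpha>..\<beta>} (\<lambda>u. \<gamma> ((u - \<alpha>) / (\<beta> - \<alpha>)))"
    by (rule continuous_on_compose2[OF assms(2)]) (use assms(1) in01 in \<open>auto intro!: continuous_intros\<close>)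
  show "{(p, H p) | p. p \<in> D} = (\<lambda>u. (\<gamma> ((u - \<alpha>) / (\<beta> - \<alpha>)), u)) ` {\<alpha>..\<beta>}"
  proof (intro set_eqI iffI)
    fix x assume "x \<in> {(p, H p) | p. p \<in> D}"
    then obtain t where t: "t \<in> {0..1}" "x = (\<gamma> t, \<alpha> + (\<beta> - \<alpha>) * t)"
      using assms(3) height by blast
    have "(\<beta> - \<alpha>) * t \<le> \<beta> - \<alpha>"
      using t(1) assms(1) by (intro mult_left_le) auto
    then have "\<alpha> + (\<beta> - \<alpha>) * t \<le> \<beta>" by linarith
    moreover have "\<alpha> \<le> \<alpha> + (\<beta> - \<alpha>) * t" using t(1) assms(1) by simp
    ultimately have "\<alpha> + (\<beta> - \<alpha>) * t \<in> {\<alpha>..\<beta>}" by (simp only: atLeastAtMost_iff simp_thms)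
    moreover have "x = (\<gamma> ((\<alpha> + (\<beta> - \<alpha>) * t - \<alpha>) / (\<beta> - \<alpha>)), \<alpha> + (\<beta> - \<alpha>) * t)"
      using t(2) assms(1) by simp
    ultimately show "x \<in> (\<lambda>u. (\<gamma> ((u - \<alpha>) / (\<beta> - \<alpha>)), u)) ` {\<alpha>..\<beta>}" by blast
  next
    fix x assume "x \<in> (\<lambda>u. (\<gamma> ((u - \<alpha>) / (\<beta> - \<alpha>)), u)) ` {\<alpha>..\<beta>}"
    then obtain u where u: "u \<in> {\<alpha>..\<beta>}" "x = (\<gamma> ((u - \<alpha>) / (\<beta> - \<alpha>)), u)" by blast
    have "H (\<gamma> ((u - \<alpha>) / (\<beta> - \<alpha>))) = u" using height[OF in01[OF u(1)]] assms(1) by simp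
    moreover have "\<gamma> ((u - \<alpha>) / (\<beta> - \<alpha>)) \<in> D" using in01[OF u(1)] assms(3) by blast
    ultimately show "x \<in> {(p, H p) | p. p \<in> D}" using u(2) by auto
  qed
qed (use assms(1) in simp_all)

lemma graph_arc_lift_Blade:
  "l i < r i \<Longrightarrow> graph_arc (lift l r (Blade i)) (l i) (r i) (Complex 0 (real i)) (Complex 1 (real i))"
  "r i < l i \<Longrightarrow> graph_arc (lift l r (Blade i)) (r i) (l i) (Complex 1 (real i)) (Complex 0 (real i))"
proof -
  have img: "(\<lambda>t. Complex t (real i)) ` {0..1} = drawn (Blade i)"
    "(\<lambda>t. Complex (1 - t) (real i)) ` {0..1} = drawn (Blade i)"
  proof -
    show "(\<lambda>t. Complex t (real i)) ` {0..1} = drawn (Blade i)"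
      unfolding set_eq_iff mem_drawn_Blade by (auto simp: image_iff complex_eq_iff)
    show "(\<lambda>t. Complex (1 - t) (real i)) ` {0..1} = drawn (Blade i)"
      unfolding set_eq_iff mem_drawn_Blade by (auto simp: image_iff complex_eq_iff intro!: bexI[of _ "1 - Re _"])
  qed
  have cont: "continuous_on {0..1} (\<lambda>t. Complex t (real i))" "continuous_on {0..1} (\<lambda>t. Complex (1 - t) (real i))"
    unfolding complex_eq by (intro continuous_intros)+
  show "graph_arc (lift l r (Blade i)) (l i) (r i) (Complex 0 (real i)) (Complex 1 (real i))" if "l i < r i"
    using graph_arcI_path[OF that cont(1) img(1), of "interpolate l r (Blade i)"] unfolding lift_def by simp
  show "graph_arc (lift l r (Blade i)) (r i) (l i) (Complex 1 (real i)) (Complex 0 (real i))" if "r i < l i"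
    using graph_arcI_path[OF that cont(2) img(2), of "interpolate l r (Blade i)"] unfolding lift_def
    by (simp add: algebra_simps)
qed

text \<open>Patterns store the smaller end first, whereas a tour may run through a tie in either
  direction.\<close>

definition pair :: "nat \<Rightarrow> nat \<Rightarrow> nat \<times> nat" where
  "pair a b = (min a b, max a b)"

lemma mem_drawn_pair:
  assumes "a \<noteq> b"
  shows "z \<in> drawn (LeftTie (pair a b)) \<longleftrightarrow> Re z \<le> 0 \<and> (Re z)\<^sup>2 = (Im z - real a) * (real b - Im z)"
    and "z \<in> drawn (RightTie (pair a b)) \<longleftrightarrow> 1 \<le> Re z \<and> (Re z - 1)\<^sup>2 = (Im z - real a) * (real b - Im z)"
proof -
  have comm: "(Im z - real b) * (real a - Im z) = (Im z - real a) * (real b - Im z)" by (simp add: algebra_simps)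
  show "z \<in> drawn (LeftTie (pair a b)) \<longleftrightarrow> Re z \<le> 0 \<and> (Re z)\<^sup>2 = (Im z - real a) * (real b - Im z)"
    "z \<in> drawn (RightTie (pair a b)) \<longleftrightarrow> 1 \<le> Re z \<and> (Re z - 1)\<^sup>2 = (Im z - real a) * (real b - Im z)"
    using assms comm mem_drawn_LeftTie[of a b z] mem_drawn_LeftTie[of b a z]
      mem_drawn_RightTie[of a b z] mem_drawn_RightTie[of b a z]
    unfolding pair_def by (cases "a < b"; simp del: drawn.simps add: min_def max_def)+
qed

text \<open>Affine interpolation reads the same from both ends, so a tie can be described from the
  end at which it is entered, be it the smaller or the larger.\<close>

lemma interpolate_pair:
  assumes "a \<noteq> b"
  shows "interpolate l r (LeftTie (pair a b)) z = l a + (l b - l a) * ((Im z - real a) / (real b - real a))"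
    and "interpolate l r (RightTie (pair a b)) z = r a + (r b - r a) * ((Im z - real a) / (real b - real a))"
proof -
  have flip: "x + (y - x) * ((t - real b) / (real a - real b)) = y + (x - y) * ((t - real a) / (real b - real a))"
    for x y t :: real
  proof -
    have "(t - real b) / (real a - real b) = (real b - t) / (real b - real a)"
      by (metis minus_diff_eq minus_divide_divide)
    also have "\<dots> = ((real b - real a) - (t - real a)) / (real b - real a)" by simp
    also have "\<dots> = 1 - (t - real a) / (real b - real a)"
      using assms by (subst diff_divide_distrib) simp
    finally have eq: "(t - real b) / (real a - real b) = 1 - (t - real a) / (real b - real a)" .
    have "x + (y - x) * (1 - q) = y + (x - y) * q" for q by (simp add: algebra_simps)
    then show ?thesis unfolding eq .
  qed
  show "interpolate l r (LeftTie (pair a b)) z = l a + (l b - l a) * ((Im z - real a) / (real b - real a))"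
    "interpolate l r (RightTie (pair a b)) z = r a + (r b - r a) * ((Im z - real a) / (real b - real a))"
    using flip[of "l b" "l a"] flip[of "r b" "r a"] assms
    by (cases "a < b"; simp only: pair_def min_def max_def interpolate.simps; simp)+
qed

text \<open>The parameter is the relative position of the imaginary part, because the height is
  affine in it. With \<open>y = a + (b - a) * t\<close> the circle equation has right-hand side
  \<open>(b - a)\<^sup>2 * (t * (1 - t))\<close>, whose root appears in \<open>\<gamma>\<close>;
  \<open>\<sigma>\<close> selects the side.\<close>

lemma semicircle_path:
  fixes a b c \<sigma> :: real
  assumes "a \<noteq> b" "\<sigma> = 1 \<or> \<sigma> = -1"
  defines "\<gamma> \<equiv> \<lambda>t. Complex (c + \<sigma> * (\<bar>b - a\<bar> * sqrt (t * (1 - t)))) (a + (b - a) * t)"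
  shows "continuous_on {0..1} \<gamma>"
    and "\<gamma> ` {0..1} = {z. 0 \<le> \<sigma> * (Re z - c) \<and> (Re z - c)\<^sup>2 = (Im z - a) * (b - Im z)}"
    and "(Im (\<gamma> t) - a) / (b - a) = t"
    and "\<gamma> 0 = Complex c a" "\<gamma> 1 = Complex c b"
proof -
  show "continuous_on {0..1} \<gamma>" unfolding \<gamma>_def complex_eq by (intro continuous_intros)
  show "\<gamma> ` {0..1} = {z. 0 \<le> \<sigma> * (Re z - c) \<and> (Re z - c)\<^sup>2 = (Im z - a) * (b - Im z)}"
  proof (intro set_eqI iffI)
    fix z assume "z \<in> \<gamma> ` {0..1}"
    then obtain t where t: "0 \<le> t" "t \<le> 1" "z = \<gamma> t" by auto
    have "(\<bar>b - a\<bar> * sqrt (t * (1 - t)))\<^sup>2 = (b - a)\<^sup>2 * (t * (1 - t))"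
      using t by (simp add: power_mult_distrib)
    also have "\<dots> = (Im z - a) * (b - Im z)"
      by (simp add: t(3) \<gamma>_def power2_eq_square algebra_simps)
    finally show "z \<in> {z. 0 \<le> \<sigma> * (Re z - c) \<and> (Re z - c)\<^sup>2 = (Im z - a) * (b - Im z)}"
      using assms(2) t by (auto simp: \<gamma>_def)
  next
    fix z assume "z \<in> {z. 0 \<le> \<sigma> * (Re z - c) \<and> (Re z - c)\<^sup>2 = (Im z - a) * (b - Im z)}"
    then have z: "0 \<le> \<sigma> * (Re z - c)" "(Re z - c)\<^sup>2 = (Im z - a) * (b - Im z)" by auto
    define t where "t = (Im z - a) / (b - a)"
    have im: "Im z = a + (b - a) * t" using assms(1) by (simp add: t_def)
    have sq: "(Re z - c)\<^sup>2 = (b - a)\<^sup>2 * (t * (1 - t))"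
      unfolding z(2) im by (simp add: power2_eq_square algebra_simps)
    then have "0 \<le> (b - a)\<^sup>2 * (t * (1 - t))" using zero_le_power2[of "Re z - c"] by simp
    then have "0 \<le> t * (1 - t)" using assms(1) by (simp add: zero_le_mult_iff)
    then have t: "t \<in> {0..1}" by (auto simp: zero_le_mult_iff)
    have "\<bar>Re z - c\<bar> = \<bar>b - a\<bar> * sqrt (t * (1 - t))"
      using arg_cong[OF sq, of sqrt] by (simp add: real_sqrt_mult)
    then have "z = \<gamma> t"
      using z(1) assms(2) im by (auto simp: \<gamma>_def complex_eq_iff)
    then show "z \<in> \<gamma> ` {0..1}" using t by blast
  qed
qed (use assms(1) in \<open>simp_all add: \<gamma>_def\<close>)

lemma graph_arc_lift_tie:
  assumes "a \<noteq> b"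
  shows "l a < l b \<Longrightarrow> graph_arc (lift l r (LeftTie (pair a b))) (l a) (l b) (Complex 0 (real a)) (Complex 0 (real b))"
    and "r a < r b \<Longrightarrow> graph_arc (lift l r (RightTie (pair a b))) (r a) (r b) (Complex 1 (real a)) (Complex 1 (real b))"
proof -
  have ab: "real a \<noteq> real b" using assms by simp
  show "graph_arc (lift l r (LeftTie (pair a b))) (l a) (l b) (Complex 0 (real a)) (Complex 0 (real b))" if "l a < l b"
  proof -
    let ?\<gamma> = "\<lambda>t. Complex (0 + -1 * (\<bar>real b - real a\<bar> * sqrt (t * (1 - t)))) (real a + (real b - real a) * t)"
    have "?\<gamma> ` {0..1} = drawn (LeftTie (pair a b))"
      using semicircle_path(2)[OF ab, of "-1" 0] mem_drawn_pair(1)[OF assms] by auto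
    from graph_arcI_path[OF that semicircle_path(1)[OF ab, of "-1" 0] this, of "interpolate l r (LeftTie (pair a b))"]
    show ?thesis
      using semicircle_path(3)[OF ab, of "-1" 0] unfolding lift_def interpolate_pair(1)[OF assms] by simp
  qed
  show "graph_arc (lift l r (RightTie (pair a b))) (r a) (r b) (Complex 1 (real a)) (Complex 1 (real b))" if "r a < r b"
  proof -
    let ?\<gamma> = "\<lambda>t. Complex (1 + 1 * (\<bar>real b - real a\<bar> * sqrt (t * (1 - t)))) (real a + (real b - real a) * t)"
    have "?\<gamma> ` {0..1} = drawn (RightTie (pair a b))"
      using semicircle_path(2)[OF ab, of 1 1] mem_drawn_pair(2)[OF assms] by auto
    from graph_arcI_path[OF that semicircle_path(1)[OF ab, of 1 1] this, of "interpolate l r (RightTie (pair a b))"]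
    show ?thesis
      using semicircle_path(3)[OF ab, of 1 1] unfolding lift_def interpolate_pair(2)[OF assms] by simp
  qed
qed

section \<open>Tours\<close>

text \<open>The cyclic order in which the curve runs through the blades; it leaves blade \<open>a\<close> at the right.\<close>

definition tour :: "pattern \<Rightarrow> pattern \<Rightarrow> nat \<Rightarrow> nat \<Rightarrow> nat \<Rightarrow> nat \<Rightarrow> nat \<Rightarrow> nat \<Rightarrow> bool" where
  "tour X Y a b c d e f \<longleftrightarrow> distinct [a, b, c, d, e, f] \<and> {a, b, c, d, e, f} = {1..6} \<and>
     X = {pair b c, pair d e, pair f a} \<and> Y = {pair a b, pair c d, pair e f}"

text \<open>At every crossing the strand that is traversed later is the upper one, if the tour starts and
  ends at blade \<open>a\<close>.\<close>

definition ascending :: "(strand \<Rightarrow> strand \<Rightarrow> bool) \<Rightarrow> nat \<Rightarrow> nat \<Rightarrow> nat \<Rightarrow> nat \<Rightarrow> nat \<Rightarrow> nat \<Rightarrow> bool" where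
  "ascending over a b c d e f \<longleftrightarrow>
     (interleave (pair a b) (pair c d) \<longrightarrow> over (RightTie (pair c d)) (RightTie (pair a b))) \<and>
     (interleave (pair a b) (pair e f) \<longrightarrow> over (RightTie (pair e f)) (RightTie (pair a b))) \<and>
     (interleave (pair c d) (pair e f) \<longrightarrow> over (RightTie (pair e f)) (RightTie (pair c d))) \<and>
     (interleave (pair b c) (pair d e) \<longrightarrow> over (LeftTie (pair d e)) (LeftTie (pair b c))) \<and>
     (interleave (pair b c) (pair f a) \<longrightarrow> over (LeftTie (pair f a)) (LeftTie (pair b c))) \<and>
     (interleave (pair d e) (pair f a) \<longrightarrow> over (LeftTie (pair f a)) (LeftTie (pair d e)))"

lemma pair_ends:
  "max (g (fst (pair a b))) (g (snd (pair a b))) = max (g a) (g b)"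
  "min (g (fst (pair a b))) (g (snd (pair a b))) = min (g a) (g b)"
  for g :: "nat \<Rightarrow> real"
  by (simp_all add: pair_def min_def max_def)

text \<open>A blade touches other strands only at its own ends. Hence the cut blade and the rest of
  the curve bound a bigon.\<close>

lemma lift_inter_Blade:
  assumes X: "tying_pattern X" and Y: "tying_pattern Y" and s: "s \<in> strands X Y" "s \<noteq> Blade i"
  shows "lift l r s \<inter> lift l r (Blade i) \<subseteq> {(Complex 1 (real i), r i), (Complex 0 (real i), l i)}"
proof
  fix x assume "x \<in> lift l r s \<inter> lift l r (Blade i)"
  then obtain p where p: "x = (p, interpolate l r (Blade i) p)" "p \<in> drawn s" "p \<in> drawn (Blade i)"
    unfolding lift_def by blast
  have "Re p = 0 \<and> Im p = real i \<or> Re p = 1 \<and> Im p = real i"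
    using s(1)
  proof (cases rule: strandsE)
    case (1 j)
    then have "i \<noteq> j" using s(2) by simp
    then show ?thesis using p(2,3) unfolding 1 mem_drawn_Blade by simp
  next
    case (2 e)
    then show ?thesis
      using blade_tie_meet(1)[of "fst e" "snd e" p i] tying_patternD(2)[OF X, of "fst e" "snd e"] p(2,3) by simp
  next
    case (3 e)
    then show ?thesis
      using blade_tie_meet(2)[of "fst e" "snd e" p i] tying_patternD(2)[OF Y, of "fst e" "snd e"] p(2,3) by simp
  qed
  then show "x \<in> {(Complex 1 (real i), r i), (Complex 0 (real i), l i)}"
    unfolding p(1) by (auto simp: complex_eq_iff)
qed

lemma strands_tour:
  assumes "tour X Y a b c d e f"
  shows "strands X Y = {Blade a, Blade b, Blade c, Blade d, Blade e, Blade f,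
    LeftTie (pair b c), LeftTie (pair d e), LeftTie (pair f a),
    RightTie (pair a b), RightTie (pair c d), RightTie (pair e f)}"
proof -
  have "{1..6} = {a, b, c, d, e, f}" "X = {pair b c, pair d e, pair f a}" "Y = {pair a b, pair c d, pair e f}"
    using assms unfolding tour_def by simp_all
  then show ?thesis unfolding strands_def by (simp only: image_insert image_empty) blast
qed

text \<open>The heights 0 to 11 number the twelve blade ends in the order of the tour, from the
  right end of \<open>a\<close> to its left end. Eleven strands climb by one unit each, and blade
  \<open>a\<close> joins the same two ends as a single graph over \<open>{0..11}\<close>.\<close>

lemma isotopic_lift_tour:
  assumes X: "tying_pattern X" and Y: "tying_pattern Y" and tour: "tour X Y a b c d e f"
    and r: "r a = 0" "r b = 1" "r c = 4" "r d = 5" "r e = 8" "r f = 9"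
    and l: "l a = 11" "l b = 2" "l c = 3" "l d = 6" "l e = 7" "l f = 10"
  shows "isotopic (\<Union>s\<in>strands X Y. lift l r s) standard_circle"
proof -
  have ne: "a \<noteq> b" "b \<noteq> c" "c \<noteq> d" "d \<noteq> e" "e \<noteq> f" "f \<noteq> a" and
    blades: "Blade b \<noteq> Blade a" "Blade c \<noteq> Blade a" "Blade d \<noteq> Blade a" "Blade e \<noteq> Blade a" "Blade f \<noteq> Blade a"
    using tour unfolding tour_def by auto
  have right: "graph_arc (lift l r (RightTie (pair i j))) (r i) (r j) (Complex 1 (real i)) (Complex 1 (real j))"
    if "i \<noteq> j" "r i < r j" for i j
    using graph_arc_lift_tie(2)[OF that] .
  have left: "graph_arc (lift l r (LeftTie (pair i j))) (l i) (l j) (Complex 0 (real i)) (Complex 0 (real j))"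
    if "i \<noteq> j" "l i < l j" for i j
    using graph_arc_lift_tie(1)[OF that] .
  have "graph_arc (lift l r (RightTie (pair a b))) 0 1 (Complex 1 a) (Complex 1 b)"
    using right[OF ne(1)] r by simp
  moreover have "graph_arc (lift l r (Blade b)) 1 2 (Complex 1 b) (Complex 0 b)"
    using graph_arc_lift_Blade(2)[of r b l] r l by simp
  ultimately have "graph_arc (lift l r (RightTie (pair a b)) \<union> lift l r (Blade b)) 0 2 (Complex 1 a) (Complex 0 b)"
    by (rule graph_arc_join) simp_all
  moreover have "graph_arc (lift l r (LeftTie (pair b c))) 2 3 (Complex 0 b) (Complex 0 c)"
    using left[OF ne(2)] l by simp
  ultimately have "graph_arc (lift l r (RightTie (pair a b)) \<union> lift l r (Blade b) \<union> lift l r (LeftTie (pair b c)))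
      0 3 (Complex 1 a) (Complex 0 c)"
    by (rule graph_arc_join) simp_all
  moreover have "graph_arc (lift l r (Blade c)) 3 4 (Complex 0 c) (Complex 1 c)"
    using graph_arc_lift_Blade(1)[of l c r] r l by simp
  ultimately have "graph_arc (lift l r (RightTie (pair a b)) \<union> lift l r (Blade b) \<union> lift l r (LeftTie (pair b c)) \<union>
      lift l r (Blade c)) 0 4 (Complex 1 a) (Complex 1 c)"
    by (rule graph_arc_join) simp_all
  moreover have "graph_arc (lift l r (RightTie (pair c d))) 4 5 (Complex 1 c) (Complex 1 d)"
    using right[OF ne(3)] r by simp
  ultimately have "graph_arc (lift l r (RightTie (pair a b)) \<union> lift l r (Blade b) \<union> lift l r (LeftTie (pair b c)) \<union>
      lift l r (Blade c) \<union> lift l r (RightTie (pair c d))) 0 5 (Complex 1 a) (Complex 1 d)"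
    by (rule graph_arc_join) simp_all
  moreover have "graph_arc (lift l r (Blade d)) 5 6 (Complex 1 d) (Complex 0 d)"
    using graph_arc_lift_Blade(2)[of r d l] r l by simp
  ultimately have "graph_arc (lift l r (RightTie (pair a b)) \<union> lift l r (Blade b) \<union> lift l r (LeftTie (pair b c)) \<union>
      lift l r (Blade c) \<union> lift l r (RightTie (pair c d)) \<union> lift l r (Blade d)) 0 6 (Complex 1 a) (Complex 0 d)"
    by (rule graph_arc_join) simp_all
  moreover have "graph_arc (lift l r (LeftTie (pair d e))) 6 7 (Complex 0 d) (Complex 0 e)"
    using left[OF ne(4)] l by simp
  ultimately have "graph_arc (lift l r (RightTie (pair a b)) \<union> lift l r (Blade b) \<union> lift l r (LeftTie (pair b c)) \<union>
      lift l r (Blade c) \<union> lift l r (RightTie (pair c d)) \<union> lift l r (Blade d) \<union> lift l r (LeftTie (pair d e)))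
      0 7 (Complex 1 a) (Complex 0 e)"
    by (rule graph_arc_join) simp_all
  moreover have "graph_arc (lift l r (Blade e)) 7 8 (Complex 0 e) (Complex 1 e)"
    using graph_arc_lift_Blade(1)[of l e r] r l by simp
  ultimately have "graph_arc (lift l r (RightTie (pair a b)) \<union> lift l r (Blade b) \<union> lift l r (LeftTie (pair b c)) \<union>
      lift l r (Blade c) \<union> lift l r (RightTie (pair c d)) \<union> lift l r (Blade d) \<union> lift l r (LeftTie (pair d e)) \<union>
      lift l r (Blade e)) 0 8 (Complex 1 a) (Complex 1 e)"
    by (rule graph_arc_join) simp_all
  moreover have "graph_arc (lift l r (RightTie (pair e f))) 8 9 (Complex 1 e) (Complex 1 f)"
    using right[OF ne(5)] r by simp
  ultimately have "graph_arc (lift l r (RightTie (pair a b)) \<union> lift l r (Blade b) \<union> lift l r (LeftTie (pair b c)) \<union>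
      lift l r (Blade c) \<union> lift l r (RightTie (pair c d)) \<union> lift l r (Blade d) \<union> lift l r (LeftTie (pair d e)) \<union>
      lift l r (Blade e) \<union> lift l r (RightTie (pair e f))) 0 9 (Complex 1 a) (Complex 1 f)"
    by (rule graph_arc_join) simp_all
  moreover have "graph_arc (lift l r (Blade f)) 9 10 (Complex 1 f) (Complex 0 f)"
    using graph_arc_lift_Blade(2)[of r f l] r l by simp
  ultimately have "graph_arc (lift l r (RightTie (pair a b)) \<union> lift l r (Blade b) \<union> lift l r (LeftTie (pair b c)) \<union>
      lift l r (Blade c) \<union> lift l r (RightTie (pair c d)) \<union> lift l r (Blade d) \<union> lift l r (LeftTie (pair d e)) \<union>
      lift l r (Blade e) \<union> lift l r (RightTie (pair e f)) \<union> lift l r (Blade f)) 0 10 (Complex 1 a) (Complex 0 f)"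
    by (rule graph_arc_join) simp_all
  moreover have "graph_arc (lift l r (LeftTie (pair f a))) 10 11 (Complex 0 f) (Complex 0 a)"
    using left[OF ne(6)] l by simp
  ultimately have S: "graph_arc (lift l r (RightTie (pair a b)) \<union> lift l r (Blade b) \<union> lift l r (LeftTie (pair b c)) \<union>
      lift l r (Blade c) \<union> lift l r (RightTie (pair c d)) \<union> lift l r (Blade d) \<union> lift l r (LeftTie (pair d e)) \<union>
      lift l r (Blade e) \<union> lift l r (RightTie (pair e f)) \<union> lift l r (Blade f) \<union> lift l r (LeftTie (pair f a)))
      0 11 (Complex 1 a) (Complex 0 a)" (is "graph_arc ?S _ _ _ _")
    by (rule graph_arc_join) simp_all
  have T: "graph_arc (lift l r (Blade a)) 0 11 (Complex 1 a) (Complex 0 a)"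
    using graph_arc_lift_Blade(2)[of r a l] r l by simp
  have "lift l r s \<inter> lift l r (Blade a) \<subseteq> {(Complex 1 a, 0), (Complex 0 a, 11)}"
    if "s \<in> strands X Y" "s \<noteq> Blade a" for s
    using lift_inter_Blade[OF X Y that, of l r] unfolding r(1) l(1) .
  then have "?S \<inter> lift l r (Blade a) \<subseteq> {(Complex 1 a, 0), (Complex 0 a, 11)}"
    unfolding strands_tour[OF tour] Int_Un_distrib2 Un_subset_iff
    using blades by (simp only: insert_iff strand.distinct simp_thms)
  then have "isotopic (?S \<union> lift l r (Blade a)) standard_circle"
    by (rule graph_arc_bigon_isotopic[OF S T, rotated]) simp
  moreover have "(\<Union>s\<in>strands X Y. lift l r s) = ?S \<union> lift l r (Blade a)"
    unfolding strands_tour[OF tour] by (simp only: UN_insert UN_empty Un_empty_left Un_empty_right Un_ac)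
  ultimately show ?thesis by (simp only:)
qed

text \<open>Of two ties on one side, the later one has both ends higher than both ends of the
  earlier one, so this numbering realises an ascending choice.\<close>

lemma ascending_tour:
  assumes X: "tying_pattern X" and Y: "tying_pattern Y" and over: "crossing_choice X Y over"
    and tour: "tour X Y a b c d e f" and asc: "ascending over a b c d e f"
  obtains K where "has_diagram X Y over K" "isotopic K standard_circle"
proof -
  define l :: "nat \<Rightarrow> real" where "l = (\<lambda>_. 0)(a := 11, b := 2, c := 3, d := 6, e := 7, f := 10)"
  define r :: "nat \<Rightarrow> real" where "r = (\<lambda>_. 0)(a := 0, b := 1, c := 4, d := 5, e := 8, f := 9)"
  have dist: "distinct [a, b, c, d, e, f]" and XY: "X = {pair b c, pair d e, pair f a}" "Y = {pair a b, pair c d, pair e f}"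
    using tour by (simp_all add: tour_def)
  have r: "r a = 0" "r b = 1" "r c = 4" "r d = 5" "r e = 8" "r f = 9"
    and l: "l a = 11" "l b = 2" "l c = 3" "l d = 6" "l e = 7" "l f = 10"
    using dist by (auto simp: l_def r_def)
  have notover: "\<not> over t s" if "over s t" "crosses s t" "s \<in> strands X Y" "t \<in> strands X Y" for s t
    using over that unfolding crossing_choice_def by blast
  have tie: "LeftTie u \<in> strands X Y" if "u \<in> X" for u using that by (simp add: strands_def)
  have tie': "RightTie u \<in> strands X Y" if "u \<in> Y" for u using that by (simp add: strands_def)
  have "has_diagram X Y over (\<Union>s\<in>strands X Y. lift l r s)"
  proof (rule has_diagram_lift[OF X Y])
    fix u v assume uv: "u \<in> X" "v \<in> X" "interleave u v" "over (LeftTie u) (LeftTie v)"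
    \<comment> \<open>Only one strand is upper at a crossing; this refutes the cases in which
      \<open>ascending\<close> would put \<open>v\<close> above \<open>u\<close>.\<close>
    have "\<not> over (LeftTie v) (LeftTie u)"
      using notover[of "LeftTie u" "LeftTie v"] tie uv by (simp add: interleave_sym[of v u])
    then show "max (l (fst v)) (l (snd v)) < min (l (fst u)) (l (snd u))"
      using uv asc unfolding XY ascending_def insert_iff empty_iff
      by (elim disjE FalseE) (simp_all add: pair_ends l interleave_irrefl)
  next
    fix u v assume uv: "u \<in> Y" "v \<in> Y" "interleave u v" "over (RightTie u) (RightTie v)"
    have "\<not> over (RightTie v) (RightTie u)"
      using notover[of "RightTie u" "RightTie v"] tie' uv by (simp add: interleave_sym[of v u])
    then show "max (r (fst v)) (r (snd v)) < min (r (fst u)) (r (snd u))"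
      using uv asc unfolding XY ascending_def insert_iff empty_iff
      by (elim disjE FalseE) (simp_all add: pair_ends r interleave_irrefl)
  qed
  then show thesis
    using that isotopic_lift_tour[OF X Y tour r l] by blast
qed

section \<open>Mirror images and the choice of the cut\<close>

lemma has_diagram_mirror:
  assumes "has_diagram X Y over K"
  shows "has_diagram X Y (\<lambda>s t. over t s) ((\<lambda>(z, u). (z, - u)) ` K)"
proof -
  obtain h where h: "\<forall>s\<in>strands X Y. continuous_on (drawn s) (h s)"
    "\<forall>s\<in>strands X Y. \<forall>t\<in>strands X Y. \<forall>p\<in>drawn s \<inter> drawn t.
       if crosses s t then over s t \<longrightarrow> h t p < h s p else h s p = h t p"
    "K = {(p, h s p) | s p. s \<in> strands X Y \<and> p \<in> drawn s}"
    using assms unfolding has_diagram_def by (elim exE conjE)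
  show ?thesis
    unfolding has_diagram_def
  proof (intro exI[of _ "\<lambda>s p. - h s p"] conjI ballI)
    show "continuous_on (drawn s) (\<lambda>p. - h s p)" if "s \<in> strands X Y" for s
      using h(1) that by (auto intro!: continuous_intros simp del: drawn.simps)
    show "if crosses s t then over t s \<longrightarrow> - h t p < - h s p else - h s p = - h t p"
      if "s \<in> strands X Y" "t \<in> strands X Y" "p \<in> drawn s \<inter> drawn t" for s t p
    proof -
      have "p \<in> drawn t \<inter> drawn s" using that(3) by blast
      from h(2)[THEN bspec, THEN bspec, THEN bspec, OF that(2,1) this] show ?thesis
        by (simp add: crosses_sym[of t s] split: if_splits)
    qed
    show "(\<lambda>(z, u). (z, - u)) ` K = {(p, - h s p) | s p. s \<in> strands X Y \<and> p \<in> drawn s}"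
      unfolding h(3) by (auto simp: image_iff simp del: drawn.simps)
  qed
qed

text \<open>The standard circle lies at height 0, so the reflection maps it to itself.\<close>

lemma isotopic_mirror:
  assumes "isotopic K standard_circle"
  shows "isotopic ((\<lambda>(z, u). (z, - u)) ` K) standard_circle"
proof -
  have "homeomorphism UNIV UNIV (\<lambda>(z, u). (z, - u) :: space) (\<lambda>(z, u). (z, - u))"
    by (intro homeomorphismI) (auto simp: case_prod_beta intro!: continuous_intros)
  from isotopic_homeomorphic_image[OF assms this]
  have "isotopic ((\<lambda>(z, u). (z, - u)) ` K) ((\<lambda>(z, u). (z, - u)) ` standard_circle)" .
  moreover have "(\<lambda>(z, u). (z, - u)) ` standard_circle = standard_circle"
    by (auto simp: standard_circle_def image_iff)
  ultimately show ?thesis by simp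
qed

text \<open>The second disjunct is the descending case, which negating heights reduces to the first.
  It also accounts for running through the same cut curve in the opposite direction.\<close>

definition monotone_cut :: "(strand \<Rightarrow> strand \<Rightarrow> bool) \<Rightarrow> nat \<Rightarrow> nat \<Rightarrow> nat \<Rightarrow> nat \<Rightarrow> nat \<Rightarrow> nat \<Rightarrow> bool" where
  "monotone_cut over a b c d e f \<longleftrightarrow> ascending over a b c d e f \<or> ascending (\<lambda>s t. over t s) a b c d e f"

text \<open>The monotone cut, possibly after reflection, provides one lift isotopic to the circle;
  uniqueness of lifts carries this over to all others.\<close>

lemma monotone_tour_trivial:
  assumes X: "tying_pattern X" and Y: "tying_pattern Y" and over: "crossing_choice X Y over"
    and tour: "tour X Y a b c d e f"
    and mono: "monotone_cut over a b c d e f"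
  shows "(\<exists>K. has_diagram X Y over K) \<and> (\<forall>K. has_diagram X Y over K \<longrightarrow> trivial_knot K)"
proof -
  obtain K where K: "has_diagram X Y over K" "isotopic K standard_circle"
    using mono unfolding monotone_cut_def
  proof
    assume "ascending over a b c d e f"
    then show thesis using ascending_tour[OF X Y over tour] that by blast
  next
    assume asc: "ascending (\<lambda>s t. over t s) a b c d e f"
    have "crossing_choice X Y (\<lambda>s t. over t s)"
      using over crosses_sym unfolding crossing_choice_def by blast
    then obtain K where "has_diagram X Y (\<lambda>s t. over t s) K" "isotopic K standard_circle"
      using ascending_tour[OF X Y _ tour asc] by blast
    then show thesis
      using that has_diagram_mirror isotopic_mirror by blast
  qed
  have "trivial_knot L" if "has_diagram X Y over L" for L
    using has_diagram_unique[OF X Y over that K(1)] K(2) by (blast intro: isotopic_imp_trivial_knot isotopic_trans)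
  then show ?thesis using K(1) by blast
qed

lemma pair_commute: "pair a b = pair b a"
  by (simp add: pair_def min.commute max.commute)

text \<open>The shift is by two blades because right and left ties alternate; a shift by one would
  exchange the roles of \<open>X\<close> and \<open>Y\<close>.\<close>

lemma tour_rotate: "tour X Y a b c d e f \<Longrightarrow> tour X Y c d e f a b"
  unfolding tour_def by (simp add: insert_commute) blast

text \<open>Starting at \<open>b\<close> keeps the first tie on the right. Together with the
  rotations this makes every blade available as the cut.\<close>

lemma tour_reverse: "tour X Y a b c d e f \<Longrightarrow> tour X Y b a f e d c"
  unfolding tour_def
  by (simp add: insert_commute pair_commute[of b a] pair_commute[of d c] pair_commute[of f e]
      pair_commute[of a f] pair_commute[of e d] pair_commute[of c b]) blast

definition tour_crossings :: "nat \<Rightarrow> nat \<Rightarrow> nat \<Rightarrow> nat \<Rightarrow> nat \<Rightarrow> nat \<Rightarrow> nat" where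
  "tour_crossings a b c d e f =
     of_bool (interleave (pair a b) (pair c d)) + of_bool (interleave (pair a b) (pair e f)) +
     of_bool (interleave (pair c d) (pair e f)) + of_bool (interleave (pair b c) (pair d e)) +
     of_bool (interleave (pair b c) (pair f a)) + of_bool (interleave (pair d e) (pair f a))"

text \<open>A crossing of two ties encloses two consecutive blades, for instance \<open>b\<close>
  and \<open>c\<close> for the right ties \<open>pair a b\<close> and \<open>pair c d\<close>.
  Moving the cut into or out of this pair, with the direction kept, exchanges which tie comes first.
  The six possible crossings enclose six different pairs. Given two crossings, some blade lies in
  exactly one of their pairs and another in neither, so at one of these cuts both crossings ascend
  or both descend. Reversing the direction switches both and does no harm.\<close>

lemma exists_monotone_cut:
  assumes over: "crossing_choice X Y over" and tour: "tour X Y a b c d e f"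
    and "tour_crossings a b c d e f \<le> 2"
  shows "monotone_cut over a b c d e f \<or> monotone_cut over c d e f a b \<or> monotone_cut over e f a b c d \<or>
    monotone_cut over b a f e d c \<or> monotone_cut over d c b a f e \<or> monotone_cut over f e d c b a"
proof -
  have choice: "over s t \<longleftrightarrow> \<not> over t s" if "s \<in> strands X Y" "t \<in> strands X Y" "crosses s t" for s t
    using over that unfolding crossing_choice_def by blast
  have right: "over (RightTie u) (RightTie v) \<longleftrightarrow> \<not> over (RightTie v) (RightTie u)"
    if "interleave u v" "u \<in> Y" "v \<in> Y" for u v
    by (rule choice) (use that in \<open>simp_all add: strands_def\<close>)
  have left: "over (LeftTie u) (LeftTie v) \<longleftrightarrow> \<not> over (LeftTie v) (LeftTie u)"
    if "interleave u v" "u \<in> X" "v \<in> X" for u v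
    by (rule choice) (use that in \<open>simp_all add: strands_def\<close>)
  have mem: "pair a b \<in> Y" "pair c d \<in> Y" "pair e f \<in> Y" "pair b c \<in> X" "pair d e \<in> X" "pair f a \<in> X"
    using tour unfolding tour_def by blast+
  note flips = right[OF _ mem(1,2)] right[OF _ mem(1,3)] right[OF _ mem(2,3)]
    left[OF _ mem(4,5)] left[OF _ mem(4,6)] left[OF _ mem(5,6)]
  have pairs: "pair b a = pair a b" "pair d c = pair c d" "pair f e = pair e f"
    "pair c b = pair b c" "pair e d = pair d e" "pair a f = pair f a"
    by (rule pair_commute)+
  have inter: "interleave (pair c d) (pair a b) = interleave (pair a b) (pair c d)"
    "interleave (pair e f) (pair a b) = interleave (pair a b) (pair e f)"
    "interleave (pair e f) (pair c d) = interleave (pair c d) (pair e f)"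
    "interleave (pair d e) (pair b c) = interleave (pair b c) (pair d e)"
    "interleave (pair f a) (pair b c) = interleave (pair b c) (pair f a)"
    "interleave (pair f a) (pair d e) = interleave (pair d e) (pair f a)"
    by (rule interleave_sym)+
  \<comment> \<open>Among the 64 combinations of crossings, those with more than two contradict the
    bound; in the others only propositional reasoning about \<open>over\<close> remains.\<close>
  show ?thesis
    using assms(3) flips
    unfolding monotone_cut_def ascending_def tour_crossings_def pairs inter
    by (cases "interleave (pair a b) (pair c d)"; cases "interleave (pair a b) (pair e f)";
        cases "interleave (pair c d) (pair e f)"; cases "interleave (pair b c) (pair d e)";
        cases "interleave (pair b c) (pair f a)"; cases "interleave (pair d e) (pair f a)"; simp; blast?)
qed

lemma at_most_two_crossings_trivial:
  assumes X: "tying_pattern X" and Y: "tying_pattern Y" and tour: "tour X Y a b c d e f"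
    and "tour_crossings a b c d e f \<le> 2" and over: "crossing_choice X Y over"
  shows "(\<exists>K. has_diagram X Y over K) \<and> (\<forall>K. has_diagram X Y over K \<longrightarrow> trivial_knot K)"
proof -
  note trivial = monotone_tour_trivial[OF X Y over]
  note t = tour tour_rotate[OF tour] tour_rotate[OF tour_rotate[OF tour]]
  show ?thesis
    using exists_monotone_cut[OF over tour assms(4)]
    by (elim disjE) (erule trivial[OF t(1)] trivial[OF t(2)] trivial[OF t(3)]
        trivial[OF tour_reverse[OF t(1)]] trivial[OF tour_reverse[OF t(2)]] trivial[OF tour_reverse[OF t(3)]])+
qed

section \<open>The listed patterns and six-blades\<close>

text \<open>Among the fifteen partitions of six points into pairs only 14, 25, 36 has three mutually
  interleaving pairs, and it is not in this list.\<close>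

lemma tying_patterns:
  "X \<in> {A1, A2, B1, B2, B3, C1, C2, C3, C4, C5, C6, D1, D2, D3} \<Longrightarrow> tying_pattern X"
  unfolding tying_pattern_def A1_def A2_def B1_def B2_def B3_def C1_def C2_def C3_def C4_def C5_def C6_def D1_def D2_def D3_def
  by (elim insertE emptyE; simp)

definition at_most_two_crossings :: "pattern \<Rightarrow> pattern \<Rightarrow> bool" where
  "at_most_two_crossings X Y \<longleftrightarrow> (\<exists>a b c d e f. tour X Y a b c d e f \<and> tour_crossings a b c d e f \<le> 2)"

lemma at_most_two_crossingsI:
  "tour X Y a b c d e f \<Longrightarrow> tour_crossings a b c d e f \<le> 2 \<Longrightarrow> at_most_two_crossings X Y"
  unfolding at_most_two_crossings_def by blast

text \<open>The A and B patterns have no crossing, the C patterns one and the D patterns two; no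
  listed combination exceeds two in total.\<close>

lemma six_blades_crossings:
  assumes "(X, Y) \<in> six_blades_i \<union> six_blades_ii"
  shows "at_most_two_crossings X Y"
proof -
  have *: "{1..6::nat} = {1, 2, 3, 4, 5, 6}" by auto
  \<comment> \<open>Each tour comes from following the curve out of the right end of blade 1. That
    it visits all six blades before closing shows the drawing to be one curve, not a link.\<close>
  have
    "tour A1 A2 1 6 5 4 3 2"
    "tour A1 C2 1 5 6 4 3 2"
    "tour A1 C4 1 3 4 5 6 2"
    "tour A1 C6 1 6 5 3 4 2"
    "tour A1 D1 1 4 3 5 6 2"
    "tour A1 D2 1 3 4 6 5 2"
    "tour A1 D3 1 5 6 3 4 2"
    "tour A2 C1 1 2 3 5 4 6"
    "tour A2 C3 1 5 4 3 2 6"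
    "tour A2 C5 1 3 2 4 5 6"
    "tour A2 D1 1 4 5 3 2 6"
    "tour A2 D2 1 3 2 5 4 6"
    "tour A2 D3 1 5 4 2 3 6"
    "tour B1 B2 1 4 5 6 3 2"
    "tour B1 B3 1 6 3 4 5 2"
    "tour B1 C2 1 5 4 6 3 2"
    "tour B1 C3 1 5 4 3 6 2"
    "tour B1 C5 1 3 6 5 4 2"
    "tour B1 C6 1 6 3 5 4 2"
    "tour B1 D1 1 4 5 3 6 2"
    "tour B1 D2 1 3 6 4 5 2"
    "tour B2 B3 1 6 5 2 3 4"
    "tour B2 C1 1 2 3 5 6 4"
    "tour B2 C3 1 5 6 2 3 4"
    "tour B2 C4 1 3 2 6 5 4"
    "tour B2 C6 1 6 5 3 2 4"
    "tour B2 D2 1 3 2 5 6 4"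
    "tour B2 D3 1 5 6 3 2 4"
    "tour C1 C3 1 5 3 4 6 2"
    "tour C1 C4 1 3 5 4 6 2"
    "tour C1 C5 1 3 5 6 4 2"
    "tour C2 C4 1 3 2 6 4 5"
    "tour C2 C5 1 3 2 4 6 5"
    "tour C2 C6 1 6 4 2 3 5"
    "tour C3 C5 1 3 4 2 6 5"
    "tour C3 C6 1 6 2 4 3 5"
    "tour C4 C6 1 6 2 4 5 3"
    unfolding tour_def A1_def A2_def B1_def B2_def B3_def C1_def C2_def C3_def C4_def C5_def C6_def D1_def D2_def D3_def
      pair_def min_def max_def * by (simp_all add: insert_commute)
  note this[THEN at_most_two_crossingsI]
  then have
    "at_most_two_crossings A1 A2"
    "at_most_two_crossings A1 C2"
    "at_most_two_crossings A1 C4"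
    "at_most_two_crossings A1 C6"
    "at_most_two_crossings A1 D1"
    "at_most_two_crossings A1 D2"
    "at_most_two_crossings A1 D3"
    "at_most_two_crossings A2 C1"
    "at_most_two_crossings A2 C3"
    "at_most_two_crossings A2 C5"
    "at_most_two_crossings A2 D1"
    "at_most_two_crossings A2 D2"
    "at_most_two_crossings A2 D3"
    "at_most_two_crossings B1 B2"
    "at_most_two_crossings B1 B3"
    "at_most_two_crossings B1 C2"
    "at_most_two_crossings B1 C3"
    "at_most_two_crossings B1 C5"
    "at_most_two_crossings B1 C6"
    "at_most_two_crossings B1 D1"
    "at_most_two_crossings B1 D2"
    "at_most_two_crossings B2 B3"
    "at_most_two_crossings B2 C1"
    "at_most_two_crossings B2 C3"
    "at_most_two_crossings B2 C4"
    "at_most_two_crossings B2 C6"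
    "at_most_two_crossings B2 D2"
    "at_most_two_crossings B2 D3"
    "at_most_two_crossings C1 C3"
    "at_most_two_crossings C1 C4"
    "at_most_two_crossings C1 C5"
    "at_most_two_crossings C2 C4"
    "at_most_two_crossings C2 C5"
    "at_most_two_crossings C2 C6"
    "at_most_two_crossings C3 C5"
    "at_most_two_crossings C3 C6"
    "at_most_two_crossings C4 C6"
    unfolding tour_crossings_def pair_def min_def max_def by simp_all
  then show ?thesis
    using assms unfolding six_blades_i_def six_blades_ii_def by (elim UnE insertE emptyE) simp_all
qed

lemma six_blades_patterns:
  assumes "(X, Y) \<in> six_blades_i \<union> six_blades_ii"
  shows "tying_pattern X" "tying_pattern Y"
  using assms unfolding six_blades_i_def six_blades_ii_def
  by (elim UnE insertE emptyE; simp add: tying_patterns)+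

theorem theorem3:
  fixes X Y :: pattern and over :: "strand \<Rightarrow> strand \<Rightarrow> bool"
  assumes "(X, Y) \<in> six_blades_i \<union> six_blades_ii"
    and "crossing_choice X Y over"
  shows "(\<exists>K. has_diagram X Y over K) \<and> (\<forall>K. has_diagram X Y over K \<longrightarrow> trivial_knot K)"
proof -
  obtain a b c d e f where "tour X Y a b c d e f" "tour_crossings a b c d e f \<le> 2"
    using six_blades_crossings[OF assms(1)] unfolding at_most_two_crossings_def by blast
  then show ?thesis
    by (rule at_most_two_crossings_trivial[OF six_blades_patterns[OF assms(1)] _ _ assms(2)])
qed

end
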